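(* Let $G=(V,E)$ be a connected, undirected, unweighted, non-bipartite graph with $n$ vertices, and let $h_u^{(l)}$ ($u\in V$, $l\ge 0$) be the node features computed by a graph neural network on $G$ from initial node features $(x_v)_{v\in V}$ with update functions $\phi_l,\psi_l$ (as defined in the context). Let $u,v\in V$ and let $r\in\mathbb{N}$. Assume that $\|\nabla\phi_l\|\le\alpha$ and $\max\{\|\nabla\psi_l\|,1\}\le\beta$ for all layers $l$. Let $d_{\min}=\min\{d_u,d_v\}$ and $d_{\max}=\max\{d_u,d_v\}$. Let $\mu_n\le\cdots\le\mu_2<\mu_1=1$ be the eigenvalues of the normalized adjacency matrix $\hat A$, and let $\max\{|\mu_2|,|\mu_n|\}\le\mu$. Then $$\left\|\frac{\partial h_u^{(r)}}{\partial x_v}\right\|\le(2\alpha\beta)^r\,\frac{d_{\max}}{2}\left(\frac{2}{d_{\min}}\left(r+1+\frac{\mu^{r+1}}{1-\mu}\right)-R_{u,v}\right).$$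
   Context: $A$ is the adjacency matrix of $G$, $D$ the diagonal degree matrix, $d_v$ the degree of the vertex $v$, $L=D-A$ the Laplacian, $\hat A=D^{-1/2}AD^{-1/2}$ the normalized adjacency matrix. $L^{+}$ denotes the pseudoinverse of $L$, and $1_v\in\mathbb{R}^V$ is the indicator vector of $v$. The effective resistance between $u$ and $v$ is $R_{u,v}=(1_u-1_v)^TL^{+}(1_u-1_v)$. Graph neural network: each vertex $v$ has an initial feature vector $x_v\in\mathbb{R}^d$; set $h_v^{(0)}=x_v$ and, for $l\ge0$, $$h_v^{(l+1)}=\phi_l\Big(h_v^{(l)},\ \sum_{u\in\mathcal N(v)}\hat A_{uv}\,\psi_l\big(h_u^{(l)}\big)\Big),$$ where $\mathcal N(v)$ is the set of neighbors of $v$ and $\phi_l,\psi_l$ are (learnable, differentiable) functions between Euclidean spaces of compatible dimensions. $\nabla f$ denotes the Jacobian matrix of a map $f$ (for $\phi_l$, the Jacobian with respect to both arguments jointly). $\partial h_u^{(r)}/\partial x_v$ is the Jacobian matrix of $h_u^{(r)}$ with respect to the initial feature vector $x_v$. $\|\cdot\|$ is the matrix 2-norm; bounds such as $\|\nabla\phi_l\|\le\alpha$ are meant at every point.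
   Formalization: The hypothesis μ < 1 is added: at μ = 1 the bound is undefined, and for μ > 1 it is false (for r = 0 and u = v the left side is 1 while the right side is 1/(1−μ) < 0). *)

theory Defs
  imports "HOL-Analysis.Analysis" "Jordan_Normal_Form.Matrix"
begin

text \<open>
  Two vector libraries are used. Matrices indexed by the vertices of a graph live in
  \<open>real^'v^'v\<close> for a finite vertex type \<open>'v\<close>. Feature vectors live in \<open>real vec\<close>, whose elements
  carry their dimension, because the feature dimension may change from layer to layer.
  The notation shared by the two libraries is reserved for \<open>real^'v\<close>.
\<close>

no_notation vec_index (infixl \<open>$\<close> 100)
no_notation scalar_prod (infix \<open>\<bullet>\<close> 70)

subsection \<open>Graphs\<close>

definition simple_graph :: "('v \<Rightarrow> 'v \<Rightarrow> bool) \<Rightarrow> bool" where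
  "simple_graph E \<longleftrightarrow> symp E \<and> irreflp E"

definition connected_graph :: "('v \<Rightarrow> 'v \<Rightarrow> bool) \<Rightarrow> bool" where
  "connected_graph E \<longleftrightarrow> (\<forall>u v. E\<^sup>*\<^sup>* u v)"

definition bipartite_graph :: "('v \<Rightarrow> 'v \<Rightarrow> bool) \<Rightarrow> bool" where
  "bipartite_graph E \<longleftrightarrow> (\<exists>S. \<forall>u v. E u v \<longrightarrow> (u \<in> S \<longleftrightarrow> v \<notin> S))"

definition neighbors :: "('v \<Rightarrow> 'v \<Rightarrow> bool) \<Rightarrow> 'v \<Rightarrow> 'v set" where
  "neighbors E v = {u. E v u}"

definition vertex_degree :: "('v \<Rightarrow> 'v \<Rightarrow> bool) \<Rightarrow> 'v \<Rightarrow> nat" where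
  "vertex_degree E v = card (neighbors E v)"

definition diag_matrix :: "('v::finite \<Rightarrow> real) \<Rightarrow> real^'v^'v" where
  "diag_matrix f = (\<chi> i j. if i = j then f i else 0)"

definition adjacency :: "('v::finite \<Rightarrow> 'v \<Rightarrow> bool) \<Rightarrow> real^'v^'v" where
  "adjacency E = (\<chi> u v. if E u v then 1 else 0)"

definition laplacian :: "('v::finite \<Rightarrow> 'v \<Rightarrow> bool) \<Rightarrow> real^'v^'v" where
  "laplacian E = diag_matrix (\<lambda>v. real (vertex_degree E v)) - adjacency E"

definition norm_adjacency :: "('v::finite \<Rightarrow> 'v \<Rightarrow> bool) \<Rightarrow> real^'v^'v" where
  "norm_adjacency E =
     diag_matrix (\<lambda>v. 1 / sqrt (real (vertex_degree E v))) ** adjacency E **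
     diag_matrix (\<lambda>v. 1 / sqrt (real (vertex_degree E v)))"

text \<open>The Moore--Penrose pseudoinverse, characterised by the four Penrose equations.\<close>

definition pseudoinverse :: "real^'v^'v \<Rightarrow> real^'v^('v::finite)" where
  "pseudoinverse A = (THE X.
     A ** X ** A = A \<and> X ** A ** X = X \<and>
     Finite_Cartesian_Product.transpose (A ** X) = A ** X \<and>
     Finite_Cartesian_Product.transpose (X ** A) = X ** A)"

definition effective_resistance :: "('v::finite \<Rightarrow> 'v \<Rightarrow> bool) \<Rightarrow> 'v \<Rightarrow> 'v \<Rightarrow> real" where
  "effective_resistance E u v =
     (axis u 1 - axis v 1) \<bullet> (pseudoinverse (laplacian E) *v (axis u 1 - axis v 1))"

definition charpoly :: "real^'v^'v \<Rightarrow> real poly" where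
  "charpoly A = Determinants.det (\<chi> i j. (if i = j then [:0, 1:] else 0) - [:A $ i $ j:])"

text \<open>\<open>m 1 \<ge> \<dots> \<ge> m n\<close> are the eigenvalues of the \<open>n \<times> n\<close> matrix \<open>A\<close>, with multiplicity.\<close>

definition eigenvalues_desc :: "real^'v^'v \<Rightarrow> (nat \<Rightarrow> real) \<Rightarrow> bool" where
  "eigenvalues_desc A m \<longleftrightarrow>
     charpoly A = (\<Prod>i = 1..CARD('v). [:- m i, 1:]) \<and> antimono_on {1..CARD('v)} m"

subsection \<open>Jacobians of maps between coordinate spaces\<close>

definition vec_norm2 :: "real vec \<Rightarrow> real" where
  "vec_norm2 x = sqrt (scalar_prod x x)"

text \<open>The condition is \<open>\<le> 1\<close> rather than \<open>= 1\<close> so that the set is nonempty in dimension 0.\<close>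

definition mat_norm2 :: "real mat \<Rightarrow> real" where
  "mat_norm2 J = Sup {vec_norm2 (J *\<^sub>v x) | x. x \<in> carrier_vec (dim_col J) \<and> vec_norm2 x \<le> 1}"

text \<open>
  The type \<open>real vec\<close> contains vectors of all dimensions and has no topology in the library,
  so Frechet differentiability is spelled out on the carrier of the dimension of \<open>x\<close>.
\<close>

definition vec_differentiable_at :: "(real vec \<Rightarrow> real vec) \<Rightarrow> real vec \<Rightarrow> bool" where
  "vec_differentiable_at f x \<longleftrightarrow>
     (\<exists>J \<in> carrier_mat (dim_vec (f x)) (dim_vec x). \<forall>\<epsilon>>0. \<exists>\<delta>>0. \<forall>y \<in> carrier_vec (dim_vec x).
        vec_norm2 (y - x) < \<delta> \<longrightarrow>
        vec_norm2 (f y - f x - J *\<^sub>v (y - x)) \<le> \<epsilon> * vec_norm2 (y - x))"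

definition vec_jacobian :: "(real vec \<Rightarrow> real vec) \<Rightarrow> real vec \<Rightarrow> real mat" where
  "vec_jacobian f x = Matrix.mat (dim_vec (f x)) (dim_vec x)
     (\<lambda>(i, j). deriv (\<lambda>t. vec_index (f (x + t \<cdot>\<^sub>v unit_vec (dim_vec x) j)) i) 0)"

subsection \<open>Graph neural networks\<close>

text \<open>
  In layer \<open>l\<close> features have dimension \<open>d l\<close> and messages have dimension \<open>e l\<close>. The update
  function \<open>\<phi> l\<close> of the two arguments \<open>h\<close> and \<open>m\<close> is a map on the product space, i.e. it is
  applied to the concatenation of \<open>h\<close> and \<open>m\<close>; its Jacobian is thus the joint one.
\<close>

definition gnn_functions ::
  "(nat \<Rightarrow> nat) \<Rightarrow> (nat \<Rightarrow> nat) \<Rightarrow> (nat \<Rightarrow> real vec \<Rightarrow> real vec) \<Rightarrow> (nat \<Rightarrow> real vec \<Rightarrow> real vec) \<Rightarrow> bool"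
  where
  "gnn_functions d e \<phi> \<psi> \<longleftrightarrow> (\<forall>l.
     \<phi> l \<in> carrier_vec (d l + e l) \<rightarrow> carrier_vec (d (Suc l)) \<and>
     \<psi> l \<in> carrier_vec (d l) \<rightarrow> carrier_vec (e l) \<and>
     (\<forall>z \<in> carrier_vec (d l + e l). vec_differentiable_at (\<phi> l) z) \<and>
     (\<forall>y \<in> carrier_vec (d l). vec_differentiable_at (\<psi> l) y))"

text \<open>The sum over the neighbors is written coordinatewise, as \<open>real vec\<close> has no zero vector
  common to all dimensions.\<close>

primrec gnn_feature ::
  "('v::finite \<Rightarrow> 'v \<Rightarrow> bool) \<Rightarrow> (nat \<Rightarrow> nat) \<Rightarrow> (nat \<Rightarrow> real vec \<Rightarrow> real vec) \<Rightarrow>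
   (nat \<Rightarrow> real vec \<Rightarrow> real vec) \<Rightarrow> ('v \<Rightarrow> real vec) \<Rightarrow> nat \<Rightarrow> 'v \<Rightarrow> real vec" where
  "gnn_feature E e \<phi> \<psi> x 0 = x"
| "gnn_feature E e \<phi> \<psi> x (Suc l) = (\<lambda>v.
     \<phi> l (gnn_feature E e \<phi> \<psi> x l v @\<^sub>v
          Matrix.vec (e l) (\<lambda>i. \<Sum>u \<in> neighbors E v.
            norm_adjacency E $ v $ u * vec_index (\<psi> l (gnn_feature E e \<phi> \<psi> x l u)) i)))"

end

theory Submission
  imports Defs
begin

text \<open>
  Differentiating one layer shows that the norms \<open>\<parallel>\<partial>h\<^sub>u/\<partial>x\<^sub>v\<parallel>\<close> grow at most by the factor \<open>\<alpha> \<beta>\<close>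
  and the matrix \<open>I + A\<close>, where \<open>A\<close> is the normalized adjacency matrix, so after \<open>r\<close> layers they are
  at most \<open>(\<alpha> \<beta>)\<^sup>r ((I + A)\<^sup>r)\<^sub>u\<^sub>v \<le> (2 \<alpha> \<beta>)\<^sup>r S\<close> with \<open>S = (\<Sum>l\<le>r. (A\<^sup>l)\<^sub>u\<^sub>v)\<close>.
  Put \<open>c = 1\<^sub>u / \<surd>d\<^sub>u - 1\<^sub>v / \<surd>d\<^sub>v\<close>. As \<open>D - D\<^sup>1\<^sup>/\<^sup>2 A D\<^sup>1\<^sup>/\<^sup>2\<close> is the Laplacian, \<open>z = D\<^sup>1\<^sup>/\<^sup>2 L\<^sup>+ (1\<^sub>u - 1\<^sub>v)\<close>
  solves \<open>z - A z = c\<close> and \<open>R\<^sub>u\<^sub>,\<^sub>v = c \<bullet> z\<close>, so the sum of \<open>c \<bullet> A\<^sup>l c\<close> over \<open>l \<le> r\<close> telescopes to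
  \<open>R\<^sub>u\<^sub>,\<^sub>v - c \<bullet> A\<^sup>r\<^sup>+\<^sup>1 z\<close>. Expanding \<open>c\<close> on the left yields \<open>S\<close>; the last term is bounded by the
  spectral gap, because \<open>c\<close> is orthogonal to the eigenvector \<open>(\<surd>d\<^sub>w)\<^sub>w\<close> of the eigenvalue 1.
\<close>

subsection \<open>Spectral bounds for symmetric matrices\<close>

text \<open>Variational argument: by compactness \<open>norm (f x)\<close> attains a maximum
  \<open>s\<close> on the unit sphere of \<open>W\<close>, and self-adjointness makes the maximizer
  \<open>x\<close> an eigenvector of the square of \<open>f\<close> for \<open>s * s\<close>. Hence
  \<open>s\<close> or \<open>- s\<close> is an eigenvalue of \<open>f\<close> on
  \<open>W\<close>.\<close>

lemma selfadjoint_norm_le_on_invariant: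
  fixes f :: "'a::euclidean_space \<Rightarrow> 'a"
  assumes lin: "linear f" and sym: "\<And>x y. f x \<bullet> y = x \<bullet> f y"
    and W: "subspace W" "\<And>x. x \<in> W \<Longrightarrow> f x \<in> W"
    and eig: "\<And>x \<nu>. x \<in> W \<Longrightarrow> x \<noteq> 0 \<Longrightarrow> f x = \<nu> *\<^sub>R x \<Longrightarrow> \<bar>\<nu>\<bar> \<le> \<mu>"
    and "w \<in> W"
  shows "norm (f w) \<le> \<mu> * norm w"
proof (cases "w = 0")
  case True
  then show ?thesis using lin by (simp add: linear_0)
next
  case False
  let ?S = "sphere 0 1 \<inter> W"
  have unit: "(1 / norm y) *\<^sub>R y \<in> ?S" if "y \<in> W" "y \<noteq> 0" for y
    using that W(1) by (simp add: subspace_scale)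
  have "compact ?S"
    using W(1) by (simp add: closed_subspace compact_Int_closed)
  moreover have "?S \<noteq> {}" using unit[OF \<open>w \<in> W\<close> False] by blast
  moreover have "continuous_on ?S (\<lambda>x. norm (f x))"
    using lin by (intro continuous_on_norm linear_continuous_on) (simp add: linear_conv_bounded_linear)
  ultimately obtain x where x: "x \<in> ?S" and max: "\<And>y. y \<in> ?S \<Longrightarrow> norm (f y) \<le> norm (f x)"
    using continuous_attains_sup by meson
  define s where "s = norm (f x)"
  have bound: "norm (f y) \<le> s * norm y" if "y \<in> W" for y
  proof (cases "y = 0")
    case True
    then show ?thesis using lin by (simp add: linear_0)
  next
    case False
    have "norm (f ((1 / norm y) *\<^sub>R y)) \<le> s"
      unfolding s_def using max[OF unit[OF that False]] .
    then show ?thesis using False lin by (simp add: linear_cmul field_simps)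
  qed
  have xW: "x \<in> W" and nx: "norm x = 1" using x by auto
  \<comment> \<open>equality case of \<open>\<parallel>f x\<parallel>\<^sup>2 = f (f x) \<bullet> x \<le> \<parallel>f (f x)\<parallel> \<parallel>x\<parallel> \<le> s\<^sup>2\<close>\<close>
  have "norm (f (f x)) \<le> s * s"
    using bound[OF W(2)[OF xW]] by (simp add: s_def)
  then have "f (f x) \<bullet> f (f x) \<le> (s * s)\<^sup>2"
    by (metis norm_ge_zero power2_norm_eq_inner power_mono)
  moreover have "f (f x) \<bullet> x = s * s"
    by (simp add: sym s_def power2_norm_eq_inner flip: power2_eq_square)
  moreover have "x \<bullet> x = 1" using nx by (simp add: norm_eq_1)
  moreover have "(f (f x) - (s * s) *\<^sub>R x) \<bullet> (f (f x) - (s * s) *\<^sub>R x)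
    = f (f x) \<bullet> f (f x) - 2 * (s * s) * (f (f x) \<bullet> x) + (s * s) * (s * s) * (x \<bullet> x)"
    by (simp add: inner_diff_left inner_diff_right inner_commute)
  ultimately have "(f (f x) - (s * s) *\<^sub>R x) \<bullet> (f (f x) - (s * s) *\<^sub>R x) \<le> 0"
    by (simp add: power2_eq_square)
  then have ff: "f (f x) = (s * s) *\<^sub>R x"
    by (metis eq_iff_diff_eq_0 inner_ge_zero inner_eq_zero_iff order_antisym)
  \<comment> \<open>Since \<open>(f - s) ((f + s) x) = 0\<close>, either \<open>x\<close> is an
    eigenvector for \<open>- s\<close>, or \<open>(f + s) x\<close> is one for
    \<open>s\<close>.\<close>
  have "s \<le> \<mu>"
  proof (cases "f x + s *\<^sub>R x = 0")
    case True
    then have "f x = (- s) *\<^sub>R x" by (simp add: eq_neg_iff_add_eq_0)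
    moreover have "x \<noteq> 0" using nx by auto
    ultimately show ?thesis using eig[OF xW, of "- s"] by auto
  next
    case False
    have "f (f x + s *\<^sub>R x) = s *\<^sub>R (f x + s *\<^sub>R x)"
      using lin ff by (simp add: linear_add linear_cmul scaleR_add_right)
    moreover have "f x + s *\<^sub>R x \<in> W"
      using W xW by (simp add: subspace_add subspace_scale)
    ultimately show ?thesis using eig[OF _ False, of s] by auto
  qed
  then show ?thesis using bound[OF \<open>w \<in> W\<close>] by (meson mult_right_mono norm_ge_zero order_trans)
qed

section \<open>Characteristic polynomial and ordered eigenvalues\<close>

lemma poly_charpoly: "poly (charpoly A) \<nu> = Determinants.det (\<chi> i j. (if i = j then \<nu> else 0) - A $ i $ j)"
  unfolding charpoly_def Determinants.det_def
  by (simp add: poly_sum poly_prod of_int_poly if_distrib[of "\<lambda>p. poly p \<nu>"] cong: if_cong)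

lemma poly_charpoly_eigenvalue:
  fixes A :: "real^'n^'n"
  assumes "A *v w = \<nu> *\<^sub>R w" "w \<noteq> 0"
  shows "poly (charpoly A) \<nu> = 0"
proof -
  let ?M = "(\<chi> i j. (if i = j then \<nu> else 0) - A $ i $ j) :: real^'n^'n"
  have "?M *v w = \<nu> *\<^sub>R w - A *v w"
    by (simp add: matrix_vector_mult_def Finite_Cartesian_Product.vec_eq_iff left_diff_distrib
        sum_subtractf if_distrib[of "\<lambda>a. a * _"] cong: if_cong)
  then have "?M *v w = 0" using assms by simp
  then have "\<not> invertible ?M"
    using assms(2) matrix_left_invertible_ker[of ?M] unfolding invertible_def by blast
  then show ?thesis by (simp add: poly_charpoly invertible_det_nz)
qed

lemma eigenvalues_desc_eigenvalue:
  fixes A :: "real^'n^'n"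
  assumes "eigenvalues_desc A m" "A *v w = \<nu> *\<^sub>R w" "w \<noteq> 0"
  obtains i where "i \<in> {1..CARD('n)}" "\<nu> = m i"
  using poly_charpoly_eigenvalue[OF assms(2,3)] assms(1)
  by (auto simp: eigenvalues_desc_def poly_prod)

text \<open>In a decreasing list, every entry but the first lies between the last and the
  second.\<close>

lemma eigenvalues_desc_abs_le:
  fixes A :: "real^'n^'n"
  assumes "eigenvalues_desc A m" "i \<in> {1..CARD('n)}" "i \<noteq> 1"
    and "max \<bar>m 2\<bar> \<bar>m CARD('n)\<bar> \<le> \<mu>"
  shows "\<bar>m i\<bar> \<le> \<mu>"
proof -
  have mono: "antimono_on {1..CARD('n)} m"
    using assms(1) by (simp add: eigenvalues_desc_def)
  have "m i \<le> m 2" "m CARD('n) \<le> m i"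
    using monotone_onD[OF mono, of 2 i] monotone_onD[OF mono, of i "CARD('n)"] assms(2,3) by simp_all
  then show ?thesis using assms(4) by auto
qed

section \<open>Matrix algebra and the pseudoinverse\<close>

lemma matrix_distribs:
  fixes A B :: "real^'n^'m" and C :: "real^'k^'n" and D :: "real^'m^'k"
  shows "(A + B) ** C = A ** C + B ** C" "(A - B) ** C = A ** C - B ** C" "D ** (A - B) = D ** A - D ** B"
  by (simp_all add: matrix_matrix_mult_def Finite_Cartesian_Product.vec_eq_iff algebra_simps
      sum.distrib sum_subtractf)

text \<open>Uniqueness half of Penrose's theorem, which gives the definite description its value:
  two solutions share both products with \<open>A\<close>, and then
  \<open>Y = Y A Y = X A Y = X A X = X\<close>.\<close>

lemma pseudoinverse_eqI:
  assumes "A ** X ** A = A" "X ** A ** X = X"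
    "Finite_Cartesian_Product.transpose (A ** X) = A ** X"
    "Finite_Cartesian_Product.transpose (X ** A) = X ** A"
  shows "pseudoinverse A = X"
  unfolding pseudoinverse_def
proof (rule the_equality)
  fix Y
  assume Y: "A ** Y ** A = A \<and> Y ** A ** Y = Y \<and>
     Finite_Cartesian_Product.transpose (A ** Y) = A ** Y \<and>
     Finite_Cartesian_Product.transpose (Y ** A) = Y ** A"
  have "A ** X = (A ** Y) ** (A ** X)"
    using Y by (simp add: matrix_mul_assoc)
  \<comment> \<open>Both factors are symmetric, so transposing reverses their order, and
    \<open>A ** X ** A\<close> collapses to \<open>A\<close>.\<close>
  also have "\<dots> = Finite_Cartesian_Product.transpose (A ** X ** A ** Y)"
    using Y assms(3) by (metis matrix_transpose_mul matrix_mul_assoc)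
  finally have AX: "A ** X = A ** Y" using Y assms(1) by simp
  have "X ** A = (X ** A) ** (Y ** A)"
    using Y by (metis matrix_mul_assoc)
  also have "\<dots> = Finite_Cartesian_Product.transpose (Y ** (A ** X ** A))"
    using Y assms(4) by (metis matrix_transpose_mul matrix_mul_assoc)
  finally have XA: "X ** A = Y ** A" using Y assms(1) by simp
  show "Y = X"
    using Y assms(2) AX XA by (metis matrix_mul_assoc)
qed (use assms in blast)

subsection \<open>Walks and effective resistance\<close>

definition deg :: "('v::finite \<Rightarrow> 'v \<Rightarrow> bool) \<Rightarrow> 'v \<Rightarrow> real" where
  "deg E w = real (vertex_degree E w)"

lemma laplacian_mult:
  "(laplacian E *v f) $ i = (\<Sum>j\<in>neighbors E i. f $ i - f $ j)"
proof -
  have "(laplacian E *v f) $ i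
    = (\<Sum>j\<in>UNIV. if i = j then deg E i * f $ j else 0) - (\<Sum>j\<in>UNIV. if E i j then f $ j else 0)"
    by (simp add: laplacian_def diag_matrix_def adjacency_def matrix_vector_mult_def deg_def
        left_diff_distrib sum_subtractf if_distrib[of "\<lambda>a. a * _"] cong: if_cong)
  also have "(\<Sum>j\<in>UNIV. if E i j then f $ j else 0) = (\<Sum>j\<in>neighbors E i. f $ j)"
    by (simp add: neighbors_def sum.If_cases)
  finally show ?thesis
    by (simp add: sum_subtractf deg_def vertex_degree_def)
qed

lemma diag_matrix_mult_nth:
  "(diag_matrix f ** M) $ i $ j = f i * M $ i $ j"
  "(M ** diag_matrix f) $ i $ j = M $ i $ j * f j"
  by (simp_all add: matrix_matrix_mult_def diag_matrix_def if_distrib[of "\<lambda>a. a * _"]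
      if_distrib[of "\<lambda>a. _ * a"] cong: if_cong)

lemma norm_adjacency_nth:
  "norm_adjacency E $ i $ j = (if E i j then 1 / sqrt (deg E i) / sqrt (deg E j) else 0)"
  by (simp add: norm_adjacency_def diag_matrix_mult_nth adjacency_def deg_def)

lemma norm_adjacency_mult:
  "(norm_adjacency E *v f) $ i = (\<Sum>j\<in>neighbors E i. norm_adjacency E $ i $ j * f $ j)"
proof -
  have "(\<Sum>j\<in>UNIV. norm_adjacency E $ i $ j * f $ j) = (\<Sum>j\<in>neighbors E i. norm_adjacency E $ i $ j * f $ j)"
    by (rule sum.mono_neutral_right) (auto simp: norm_adjacency_nth neighbors_def)
  then show ?thesis by (simp add: matrix_vector_mult_def)
qed

text \<open>Maximum principle: at a vertex where \<open>f\<close> is maximal, the differences to the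
  neighbors are nonnegative and sum to 0, so the neighbors attain the maximum too; connectedness
  spreads this to all vertices.\<close>

lemma kernel_laplacian_const:
  fixes E :: "'v::finite \<Rightarrow> 'v \<Rightarrow> bool"
  assumes "connected_graph E" "laplacian E *v f = 0"
  shows "f $ i = f $ j"
proof -
  obtain k where k: "\<And>i. f $ i \<le> f $ k"
    using Max_in[of "range (($) f)"] Max_ge[of "range (($) f)"] by fastforce
  have "f $ i = f $ k" for i
  proof -
    have "E\<^sup>*\<^sup>* k i" using assms(1) by (simp add: connected_graph_def)
    then show ?thesis
    proof (induction rule: rtranclp_induct)
      case (step y z)
      have "(\<Sum>j\<in>neighbors E y. f $ y - f $ j) = 0"
        using laplacian_mult[of E f y] assms(2) by simp
      moreover have "0 \<le> f $ y - f $ j" for j using k step by simp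
      ultimately have "f $ y - f $ z = 0"
        using step.hyps(2) by (subst (asm) sum_nonneg_eq_0_iff) (auto simp: neighbors_def)
      then show ?case using step by simp
    qed simp
  qed
  then show ?thesis by metis
qed

section \<open>Connected non-bipartite graphs and their normalized adjacency matrix\<close>

locale nonbipartite_graph =
  fixes E :: "'v::finite \<Rightarrow> 'v \<Rightarrow> bool"
  assumes simple: "simple_graph E" and conn: "connected_graph E" and nbip: "\<not> bipartite_graph E"
begin

lemma E_sym: "E i j \<longleftrightarrow> E j i"
  using simple by (auto simp: simple_graph_def symp_def)

text \<open>An edgeless graph would be bipartite. Two distinct vertices plus connectedness then
  exclude isolated vertices, so that dividing by degrees is harmless.\<close>

lemma obtain_edge: obtains p q where "E p q" "p \<noteq> q"
  using nbip simple unfolding bipartite_graph_def simple_graph_def irreflp_def by metis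

lemma deg_ge_1: "deg E w \<ge> 1"
proof -
  obtain p where "p \<noteq> w" using obtain_edge by metis
  moreover have "E\<^sup>*\<^sup>* w p" using conn by (simp add: connected_graph_def)
  ultimately obtain q where "E w q" by (metis converse_rtranclpE)
  then have "neighbors E w \<noteq> {}" by (auto simp: neighbors_def)
  then show ?thesis
    by (simp add: deg_def vertex_degree_def Suc_le_eq card_gt_0_iff)
qed

lemma deg_pos: "deg E w > 0"
  using deg_ge_1[of w] by simp

abbreviation "A \<equiv> norm_adjacency E"

lemma transpose_A: "Finite_Cartesian_Product.transpose A = A"
  by (simp add: Finite_Cartesian_Product.transpose_def Finite_Cartesian_Product.vec_eq_iff norm_adjacency_nth E_sym)

lemma A_sym: "(A *v x) \<bullet> y = x \<bullet> (A *v y)"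
  by (metis dot_lmul_matrix transpose_A vector_transpose_matrix)

lemma A_nonneg: "0 \<le> A $ i $ j"
  by (simp add: norm_adjacency_nth deg_pos less_imp_le)

text \<open>The factorization \<open>L = D^(1/2) (I - A) D^(1/2)\<close>, read coordinatewise; it
  transfers facts about the Laplacian to \<open>A\<close> and back.\<close>

lemma laplacian_conv_A:
  "(laplacian E *v f) $ i =
    sqrt (deg E i) * ((\<chi> i. sqrt (deg E i) * f $ i) - A *v (\<chi> i. sqrt (deg E i) * f $ i)) $ i"
proof -
  have "(A *v (\<chi> i. sqrt (deg E i) * f $ i)) $ i = (\<Sum>j\<in>neighbors E i. f $ j / sqrt (deg E i))"
    unfolding norm_adjacency_mult
    by (intro sum.cong) (use deg_pos in \<open>auto simp: norm_adjacency_nth neighbors_def less_imp_neq[symmetric]\<close>)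
  then have "sqrt (deg E i) * (A *v (\<chi> i. sqrt (deg E i) * f $ i)) $ i = (\<Sum>j\<in>neighbors E i. f $ j)"
    using deg_pos[of i] by (simp add: sum_divide_distrib[symmetric])
  then show ?thesis
    using deg_pos[of i]
    by (simp add: laplacian_mult right_diff_distrib sum_subtractf vertex_degree_def deg_def)
qed

text \<open>The Perron eigenvector of \<open>A\<close>, the image under \<open>D^(1/2)\<close> of
  the constant vector 1.\<close>

definition sqrt_degs :: "real^'v" where "sqrt_degs = (\<chi> i. sqrt (deg E i))"

text \<open>The eigenvalue 1 is simple because \<open>D^(-1/2) w\<close> lies in the kernel of the
  Laplacian and is therefore constant.\<close>

lemma A_fixpoint:
  assumes "A *v w = w"
  obtains k where "w = k *\<^sub>R sqrt_degs"
proof -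
  define f :: "real^'v" where "f = (\<chi> i. w $ i / sqrt (deg E i))"
  have w: "(\<chi> i. sqrt (deg E i) * f $ i) = w"
    using deg_pos by (simp add: f_def Finite_Cartesian_Product.vec_eq_iff less_imp_neq[symmetric])
  have "laplacian E *v f = 0"
    by (simp add: Finite_Cartesian_Product.vec_eq_iff laplacian_conv_A w assms)
  then obtain k where "\<And>i. f $ i = k" using kernel_laplacian_const[OF conn] by metis
  then have "w = k *\<^sub>R sqrt_degs"
    by (subst w[symmetric]) (simp add: sqrt_degs_def Finite_Cartesian_Product.vec_eq_iff)
  then show ?thesis using that by blast
qed

lemma A_sqrt_degs: "A *v sqrt_degs = sqrt_degs"
proof -
  have "sqrt (deg E i) * (sqrt_degs - A *v sqrt_degs) $ i = 0" for i
    using laplacian_conv_A[of 1 i] by (simp add: laplacian_mult sqrt_degs_def)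
  then show ?thesis using deg_pos by (simp add: Finite_Cartesian_Product.vec_eq_iff less_imp_neq[symmetric])
qed

lemma sqrt_degs_nonzero: "sqrt_degs \<bullet> sqrt_degs > 0"
  using deg_pos by (auto simp: sqrt_degs_def Finite_Cartesian_Product.vec_eq_iff less_imp_neq[symmetric])

text \<open>With \<open>P\<close> the orthogonal projection onto the constants, \<open>L + P\<close>
  is invertible and the pseudoinverse of \<open>L\<close> is \<open>(L + P)^(-1) - P\<close>. Its
  product with \<open>L\<close> is \<open>I - P\<close>, which fixes vectors of coordinate sum
  0.\<close>

lemma laplacian_pseudoinverse:
  assumes "(\<Sum>i\<in>UNIV. b $ i) = 0"
  shows "laplacian E *v (pseudoinverse (laplacian E) *v b) = b"
proof -
  let ?L = "laplacian E"
  define P :: "real^'v^'v" where "P = (\<chi> i j. 1 / CARD('v))"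
  let ?N = "?L + P"
  have Pm: "(P *v f) $ i = (\<Sum>j\<in>UNIV. f $ j) / CARD('v)" for f i
    by (simp add: P_def matrix_vector_mult_def sum_divide_distrib)
  have Lt: "Finite_Cartesian_Product.transpose ?L = ?L"
    by (auto simp: laplacian_def diag_matrix_def adjacency_def Finite_Cartesian_Product.transpose_def
        Finite_Cartesian_Product.vec_eq_iff E_sym)
  have Pt: "Finite_Cartesian_Product.transpose P = P"
    by (simp add: P_def Finite_Cartesian_Product.transpose_def)
  have PP: "P ** P = P"
    by (simp add: P_def matrix_matrix_mult_def Finite_Cartesian_Product.vec_eq_iff)
  have LP: "?L ** P = 0"
    by (auto simp: matrix_eq matrix_vector_mul_assoc[symmetric] Finite_Cartesian_Product.vec_eq_iff laplacian_mult Pm)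
  have PL: "P ** ?L = 0"
    using arg_cong[OF LP, of Finite_Cartesian_Product.transpose] by (simp add: matrix_transpose_mul Lt Pt) (simp add: Finite_Cartesian_Product.transpose_def Finite_Cartesian_Product.vec_eq_iff)
  \<comment> \<open>Applying \<open>P\<close> kills the Laplacian part and leaves
    \<open>P *v f = 0\<close>; then \<open>f\<close> is in the kernel of the Laplacian, so it is
    constant, and its mean is 0.\<close>
  have "f = 0" if "?N *v f = 0" for f
  proof -
    have "P *v (?N *v f) = P *v f"
      by (simp add: matrix_vector_mul_assoc matrix_add_ldistrib PL PP)
    then have Pf: "P *v f = 0" using that by simp
    then have "?L *v f = 0" using that by (simp add: matrix_vector_mult_add_rdistrib)
    then obtain k where k: "\<And>i. f $ i = k" using kernel_laplacian_const[OF conn] by metis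
    have "(P *v f) $ i = k" for i by (simp add: Pm k)
    then show "f = 0" using Pf k by (simp add: Finite_Cartesian_Product.vec_eq_iff)
  qed
  then obtain M where MN: "M ** ?N = Finite_Cartesian_Product.mat 1" using matrix_left_invertible_ker by blast
  then have NM: "?N ** M = Finite_Cartesian_Product.mat 1" using matrix_left_right_inverse by blast
  \<comment> \<open>\<open>?N\<close> acts as the identity on \<open>P\<close> from both sides,
    hence so does its inverse \<open>M\<close>.\<close>
  have NP: "?N ** P = P" and PN: "P ** ?N = P"
    by (simp_all add: matrix_add_ldistrib matrix_distribs LP PL PP)
  have MP: "M ** P = P" by (metis MN NP matrix_mul_assoc matrix_mul_lid)
  have PM: "P ** M = P" by (metis NM PN matrix_mul_assoc matrix_mul_rid)
  define X where "X = M - P"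
  have L_M: "?L ** M = Finite_Cartesian_Product.mat 1 - P"
    using NM PM by (simp add: matrix_distribs algebra_simps eq_diff_eq)
  have M_L: "M ** ?L = Finite_Cartesian_Product.mat 1 - P"
    using MN MP by (simp add: matrix_add_ldistrib algebra_simps eq_diff_eq)
  have LX: "?L ** X = Finite_Cartesian_Product.mat 1 - P" and XL: "X ** ?L = Finite_Cartesian_Product.mat 1 - P"
    by (simp_all add: X_def matrix_distribs L_M M_L LP PL)
  have "pseudoinverse ?L = X"
  proof (rule pseudoinverse_eqI)
    show "?L ** X ** ?L = ?L" by (simp add: LX matrix_distribs PL)
    show "X ** ?L ** X = X"
      by (simp add: XL matrix_distribs) (simp add: X_def matrix_distribs PM PP)
    show "Finite_Cartesian_Product.transpose (?L ** X) = ?L ** X"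
      "Finite_Cartesian_Product.transpose (X ** ?L) = X ** ?L"
      using Pt by (simp_all add: LX XL Finite_Cartesian_Product.transpose_def
          Finite_Cartesian_Product.vec_eq_iff Finite_Cartesian_Product.mat_def)
  qed
  then have "?L *v (pseudoinverse ?L *v b) = b - P *v b"
    by (simp add: matrix_vector_mul_assoc LX matrix_vector_mult_diff_rdistrib)
  also have "P *v b = 0" by (simp add: Finite_Cartesian_Product.vec_eq_iff Pm assms)
  finally show ?thesis by simp
qed

section \<open>Powers of \<open>A\<close> and of \<open>I + A\<close>\<close>

primrec walk :: "nat \<Rightarrow> real^'v \<Rightarrow> real^'v" where
  "walk 0 x = x"
| "walk (Suc l) x = A *v walk l x"

lemma walk_A: "walk l (A *v x) = A *v walk l x"
  by (induction l) simp_all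

lemma linear_walk: "linear (walk l)"
  by (induction l) (simp_all add: linear_iff matrix_vector_right_distrib matrix_vector_mult_scaleR)

lemma walk_sym: "walk l x \<bullet> y = x \<bullet> walk l y"
  by (induction l arbitrary: x y) (simp_all add: A_sym walk_A[symmetric])

lemma walk_nonneg: "(\<And>i. 0 \<le> x $ i) \<Longrightarrow> 0 \<le> walk l x $ i"
  by (induction l arbitrary: i) (auto simp: norm_adjacency_mult A_nonneg intro!: sum_nonneg)

lemma walk_telescope: "(\<Sum>l\<le>r. walk l (z - A *v z)) = z - walk (Suc r) z"
proof (induction r)
  case (Suc r)
  then show ?case
    using linear_diff[OF linear_walk[of "Suc r"], of z "A *v z"] by (simp add: walk_A)
qed simp

text \<open>This is \<open>(I + A)^l x\<close>, an unnormalized lazy walk; the identity part will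
  account for the dependence of a layer on the vertex's own feature.\<close>

primrec lazy_walk :: "nat \<Rightarrow> real^'v \<Rightarrow> real^'v" where
  "lazy_walk 0 x = x"
| "lazy_walk (Suc l) x = lazy_walk l x + A *v lazy_walk l x"

text \<open>With \<open>T\<close> the partial sum up to \<open>l\<close> and \<open>T'\<close> the
  one up to \<open>Suc l\<close>, nonnegativity bounds both \<open>T\<close> and \<open>A T\<close>
  by \<open>T'\<close>, so each step costs a factor 2.\<close>

lemma lazy_walk_le:
  assumes "\<And>i. 0 \<le> x $ i"
  shows "lazy_walk l x $ i \<le> 2 ^ l * (\<Sum>k\<le>l. walk k x $ i)"
proof (induction l arbitrary: i)
  case (Suc l)
  let ?T = "\<lambda>i. \<Sum>k\<le>l. walk k x $ i"
  define T' where "T' = (\<Sum>k\<le>Suc l. walk k x $ i)"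
  have "(A *v lazy_walk l x) $ i \<le> (\<Sum>j\<in>neighbors E i. A $ i $ j * (2 ^ l * ?T j))"
    unfolding norm_adjacency_mult by (intro sum_mono mult_left_mono Suc A_nonneg)
  also have "\<dots> = 2 ^ l * (\<Sum>j\<in>neighbors E i. \<Sum>k\<le>l. A $ i $ j * walk k x $ j)"
    by (simp add: sum_distrib_left mult_ac)
  also have "\<dots> = 2 ^ l * (\<Sum>k\<le>l. walk (Suc k) x $ i)"
    by (simp add: norm_adjacency_mult sum.swap[of _ "neighbors E i"])
  \<comment> \<open>The shifted sum is \<open>T'\<close> without its nonnegative term for
    \<open>k = 0\<close>.\<close>
  also have "\<dots> \<le> 2 ^ l * T'"
    using assms by (simp add: T'_def sum.atMost_Suc_shift del: sum.atMost_Suc)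
  finally have "(A *v lazy_walk l x) $ i \<le> 2 ^ l * T'" .
  moreover have "?T i \<le> T'" using walk_nonneg[OF assms, of "Suc l" i] by (simp add: T'_def)
  then have "2 ^ l * ?T i \<le> 2 ^ l * T'" by (intro mult_left_mono) auto
  then have "lazy_walk l x $ i \<le> 2 ^ l * T'" by (rule order_trans[OF Suc])
  ultimately show ?case by (simp add: T'_def[symmetric] del: sum.atMost_Suc)
qed simp

text \<open>The complement of \<open>sqrt_degs\<close> is invariant, as \<open>A\<close> is
  symmetric and fixes \<open>sqrt_degs\<close>. It contains no nonzero fixed vector, so every
  eigenvalue on it is some \<open>m i\<close> other than \<open>m 1 = 1\<close>.\<close>

lemma A_norm_le_perp:
  assumes ev: "eigenvalues_desc A m" and mu: "max \<bar>m 2\<bar> \<bar>m CARD('v)\<bar> \<le> \<mu>" "\<mu> < 1"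
    and w: "sqrt_degs \<bullet> w = 0"
  shows "norm (A *v w) \<le> \<mu> * norm w"
proof (rule selfadjoint_norm_le_on_invariant[where W = "{x. sqrt_degs \<bullet> x = 0}"])
  show "subspace {x. sqrt_degs \<bullet> x = 0}" by (rule subspace_hyperplane)
  show "A *v x \<in> {x. sqrt_degs \<bullet> x = 0}" if "x \<in> {x. sqrt_degs \<bullet> x = 0}" for x
    using that by (simp add: A_sym[symmetric] A_sqrt_degs)
  fix x \<nu> assume x: "x \<in> {x. sqrt_degs \<bullet> x = 0}" "x \<noteq> 0" "A *v x = \<nu> *\<^sub>R x"
  have "\<nu> \<noteq> 1"
  proof
    assume "\<nu> = 1"
    then obtain k where k: "x = k *\<^sub>R sqrt_degs" using x A_fixpoint[of x] by auto
    then show False using x sqrt_degs_nonzero by auto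
  qed
  \<comment> \<open>\<open>1\<close> is an eigenvalue, but not \<open>m i\<close> for any \<open>i \<noteq> 1\<close>\<close>
  have "sqrt_degs \<noteq> 0" using sqrt_degs_nonzero by auto
  then obtain i where "i \<in> {1..CARD('v)}" "m i = 1"
    using eigenvalues_desc_eigenvalue[OF ev, of sqrt_degs 1] A_sqrt_degs by auto
  then have "m 1 = 1"
    using eigenvalues_desc_abs_le[OF ev _ _ mu(1), of i] mu(2) by (cases "i = 1") auto
  then show "\<bar>\<nu>\<bar> \<le> \<mu>"
    using eigenvalues_desc_eigenvalue[OF ev x(3,2)] eigenvalues_desc_abs_le[OF ev _ _ mu(1)] \<open>\<nu> \<noteq> 1\<close>
    by metis
qed (use w A_sym in auto)

lemma perp_decompose:
  obtains k z' where "z = k *\<^sub>R sqrt_degs + z'" "sqrt_degs \<bullet> z' = 0"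
  using that[of "(sqrt_degs \<bullet> z) / (sqrt_degs \<bullet> sqrt_degs)" "z - ((sqrt_degs \<bullet> z) / (sqrt_degs \<bullet> sqrt_degs)) *\<^sub>R sqrt_degs"] sqrt_degs_nonzero
  by (simp add: inner_diff_right)

section \<open>Consequences of the spectral gap\<close>

context
  fixes m :: "nat \<Rightarrow> real" and \<mu> :: real
  assumes ev: "eigenvalues_desc A m" and mu: "max \<bar>m 2\<bar> \<bar>m CARD('v)\<bar> \<le> \<mu>" "\<mu> < 1"
begin

lemma mu_nonneg: "0 \<le> \<mu>"
  using mu(1) by auto

lemma walk_norm_le_perp: "sqrt_degs \<bullet> w = 0 \<Longrightarrow> norm (walk l w) \<le> \<mu> ^ l * norm w"
proof (induction l arbitrary: w)
  case (Suc l)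
  have "sqrt_degs \<bullet> (A *v w) = 0" using Suc.prems by (simp add: A_sym[symmetric] A_sqrt_degs)
  then have "norm (walk (Suc l) w) \<le> \<mu> ^ l * norm (A *v w)"
    using Suc.IH[of "A *v w"] by (simp add: walk_A)
  also have "\<dots> \<le> \<mu> ^ l * (\<mu> * norm w)"
    using A_norm_le_perp[OF ev mu Suc.prems] mu_nonneg by (intro mult_left_mono) auto
  finally show ?case by (simp add: mult_ac)
qed simp

text \<open>Pythagoras: the component along \<open>sqrt_degs\<close> is fixed, and the orthogonal
  one stays orthogonal and does not grow.\<close>

lemma A_norm_le: "norm (A *v w) \<le> norm w"
proof -
  obtain k w' where w: "w = k *\<^sub>R sqrt_degs + w'" "sqrt_degs \<bullet> w' = 0" using perp_decompose by blast
  have "norm (A *v w') \<le> norm w'"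
    using A_norm_le_perp[OF ev mu w(2)] mu by (smt (verit) mult_left_le_one_le norm_ge_zero mu_nonneg)
  moreover have "A *v w = k *\<^sub>R sqrt_degs + A *v w'"
    by (simp add: w(1) matrix_vector_right_distrib matrix_vector_mult_scaleR A_sqrt_degs)
  moreover have "sqrt_degs \<bullet> (A *v w') = 0" using w(2) by (simp add: A_sym[symmetric] A_sqrt_degs)
  ultimately show ?thesis
    using w by (simp add: norm_le inner_add_left inner_add_right inner_commute)
qed

lemma walk_axis_le: "axis i 1 \<bullet> walk l (axis i 1) \<le> 1"
proof -
  have "norm (walk l w) \<le> norm w" for w
    by (induction l) (auto intro: order_trans[OF A_norm_le])
  then have "norm (walk l (axis i 1)) \<le> 1" by (metis norm_axis_1)
  moreover have "axis i 1 \<bullet> walk l (axis i 1) \<le> norm (axis i (1::real)) * norm (walk l (axis i 1))"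
    by (rule norm_cauchy_schwarz)
  ultimately show ?thesis by simp
qed

text \<open>Since \<open>c\<close> is orthogonal to \<open>sqrt_degs\<close>, only the orthogonal
  part \<open>z'\<close> of \<open>z\<close> matters. There \<open>I - A\<close> is bounded below by
  \<open>1 - \<mu>\<close>, so the norm of \<open>z'\<close> is at most
  \<open>norm c / (1 - \<mu>)\<close>; moving \<open>A^l\<close> over to \<open>c\<close> by
  symmetry contributes \<open>\<mu> ^ l\<close>.\<close>

lemma walk_inner_resolvent_le:
  assumes c: "z - A *v z = c"
  shows "c \<bullet> walk l z \<le> \<mu> ^ l / (1 - \<mu>) * (norm c)\<^sup>2"
proof -
  have sc: "sqrt_degs \<bullet> c = 0" by (simp add: c[symmetric] inner_diff_right A_sym[symmetric] A_sqrt_degs)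
  obtain k z' where z: "z = k *\<^sub>R sqrt_degs + z'" "sqrt_degs \<bullet> z' = 0" using perp_decompose by blast
  have "c = z' - A *v z'"
    by (simp add: c[symmetric] z(1) matrix_vector_right_distrib matrix_vector_mult_scaleR A_sqrt_degs)
  then have "norm c \<ge> norm z' - norm (A *v z')" by (metis norm_triangle_ineq2)
  then have "norm c \<ge> (1 - \<mu>) * norm z'"
    using A_norm_le_perp[OF ev mu z(2)] by (simp add: algebra_simps)
  then have nz: "norm z' \<le> norm c / (1 - \<mu>)" using mu by (simp add: field_simps)
  have ws: "walk l sqrt_degs = sqrt_degs" by (induction l) (simp_all add: A_sqrt_degs)
  have "walk l z = k *\<^sub>R sqrt_degs + walk l z'"
    using linear_walk[of l] by (simp add: z(1) linear_add linear_cmul ws)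
  then have "c \<bullet> walk l z = walk l c \<bullet> z'"
    using sc by (simp add: inner_add_right walk_sym inner_commute[of c sqrt_degs])
  also have "\<dots> \<le> norm (walk l c) * norm z'" by (rule norm_cauchy_schwarz)
  also have "\<dots> \<le> (\<mu> ^ l * norm c) * (norm c / (1 - \<mu>))"
    using walk_norm_le_perp[OF sc] nz mu_nonneg by (intro mult_mono) auto
  finally show ?thesis by (simp add: power2_eq_square mult_ac)
qed

lemma walk_sum_le_resistance:
  fixes u v r
  defines "dmin \<equiv> min (deg E u) (deg E v)" and "dmax \<equiv> max (deg E u) (deg E v)"
  shows "(\<Sum>l\<le>r. walk l (axis v 1) $ u) \<le>
    dmax / 2 * (2 / dmin * (real r + 1 + \<mu> ^ (r + 1) / (1 - \<mu>)) - effective_resistance E u v)"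
proof -
  define a where "a = 1 / sqrt (deg E u)"
  define b where "b = 1 / sqrt (deg E v)"
  define S where "S = (\<Sum>l\<le>r. walk l (axis v 1) $ u)"
  let ?b = "axis u 1 - axis v 1 :: real^'v"
  define y where "y = pseudoinverse (laplacian E) *v ?b"
  define z where "z = (\<chi> i. sqrt (deg E i) * y $ i)"
  define c where "c = (a *\<^sub>R axis u 1 - b *\<^sub>R axis v 1 :: real^'v)"
  have ab: "a > 0" "b > 0" "a\<^sup>2 = 1 / deg E u" "b\<^sup>2 = 1 / deg E v"
    using deg_pos[of u] deg_pos[of v] by (auto simp: a_def b_def power_divide)
  have "(\<Sum>i\<in>UNIV. ?b $ i) = 0"
    by (simp add: axis_def sum_subtractf)
  then have "laplacian E *v y = ?b"
    unfolding y_def by (rule laplacian_pseudoinverse)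
  then have "sqrt (deg E i) * (z - A *v z) $ i = ?b $ i" for i
    using laplacian_conv_A[of y i] by (simp add: z_def)
  then have "(z - A *v z) $ i = ?b $ i / sqrt (deg E i)" for i
    using deg_pos[of i] by (simp add: eq_divide_eq mult.commute)
  moreover have "?b $ i / sqrt (deg E i) = c $ i" for i
    by (auto simp: c_def a_def b_def axis_def)
  ultimately have c: "z - A *v z = c" by (simp add: Finite_Cartesian_Product.vec_eq_iff)
  have R: "effective_resistance E u v = c \<bullet> z"
    using deg_pos[of u] deg_pos[of v]
    by (simp add: effective_resistance_def y_def[symmetric] c_def z_def inner_diff_left
        inner_axis' a_def b_def)
  have sum: "(\<Sum>l\<le>r. c \<bullet> walk l c) = c \<bullet> z - c \<bullet> walk (r + 1) z"
    using arg_cong[OF walk_telescope[of z r], of "\<lambda>x. c \<bullet> x"]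
    by (simp add: c inner_sum_right inner_diff_right)
  have summand: "c \<bullet> walk l c = a\<^sup>2 * (axis u 1 \<bullet> walk l (axis u 1)) + b\<^sup>2 * (axis v 1 \<bullet> walk l (axis v 1))
     - 2 * (a * b) * walk l (axis v 1) $ u" for l
  proof -
    have "walk l (axis u 1) $ v = walk l (axis v 1) $ u"
      using walk_sym[of l "axis u 1" "axis v 1"] by (simp add: inner_axis inner_axis')
    then show ?thesis
      using linear_walk[of l] by (simp add: c_def linear_diff linear_cmul inner_diff_left inner_diff_right
        inner_axis' power2_eq_square algebra_simps)
  qed
  \<comment> \<open>The two diagonal entries of \<open>A^l\<close> are bounded by 1; the mixed entry
    is kept exactly because it makes up \<open>S\<close>.\<close>
  have "c \<bullet> walk l c \<le> a\<^sup>2 + b\<^sup>2 - 2 * (a * b) * walk l (axis v 1) $ u" for l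
    unfolding summand using walk_axis_le[of u l] walk_axis_le[of v l]
    by (intro diff_right_mono add_mono mult_left_le) auto
  then have "(\<Sum>l\<le>r. c \<bullet> walk l c) \<le> (\<Sum>l\<le>r. a\<^sup>2 + b\<^sup>2 - 2 * (a * b) * walk l (axis v 1) $ u)"
    by (rule sum_mono)
  also have "\<dots> = (real r + 1) * (a\<^sup>2 + b\<^sup>2) - 2 * (a * b) * S"
    by (simp add: sum_subtractf S_def sum_distrib_left)
  finally have "2 * (a * b) * S \<le> (real r + 1) * (a\<^sup>2 + b\<^sup>2) - effective_resistance E u v + c \<bullet> walk (r + 1) z"
    using sum R by simp
  \<comment> \<open>The summand at \<open>l = 0\<close> is the squared norm of \<open>c\<close>; its
    mixed entry is 1 for \<open>u = v\<close> and 0 otherwise, and enters with a minus sign.\<close>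
  moreover have "(norm c)\<^sup>2 = a\<^sup>2 + b\<^sup>2 - 2 * (a * b) * axis v 1 $ u"
    using summand[of 0] by (simp add: power2_norm_eq_inner inner_axis_axis)
  then have "(norm c)\<^sup>2 \<le> a\<^sup>2 + b\<^sup>2"
    using ab by (simp add: axis_def)
  then have "c \<bullet> walk (r + 1) z \<le> \<mu> ^ (r + 1) / (1 - \<mu>) * (a\<^sup>2 + b\<^sup>2)"
    using mu mu_nonneg
    by (intro order_trans[OF walk_inner_resolvent_le[OF c]] mult_left_mono) auto
  ultimately have "2 * (a * b) * S \<le>
    (a\<^sup>2 + b\<^sup>2) * (real r + 1 + \<mu> ^ (r + 1) / (1 - \<mu>)) - effective_resistance E u v"
    by (simp add: algebra_simps)
  also have "\<dots> \<le> 2 / dmin * (real r + 1 + \<mu> ^ (r + 1) / (1 - \<mu>)) - effective_resistance E u v"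
  proof (intro diff_right_mono mult_right_mono)
    have "1 / deg E u \<le> 1 / dmin" "1 / deg E v \<le> 1 / dmin"
      using deg_pos[of u] deg_pos[of v] by (auto simp: dmin_def intro!: divide_left_mono)
    then show "a\<^sup>2 + b\<^sup>2 \<le> 2 / dmin" by (simp add: ab)
  qed (use mu mu_nonneg in auto)
  finally have key: "2 * (a * b) * S \<le> \<dots>" .
  \<comment> \<open>As \<open>S\<close> is nonnegative, the coefficient \<open>a * b\<close> may be
    lowered to \<open>1 / dmax\<close>, which produces the factor \<open>dmax / 2\<close>.\<close>
  have "1 / dmax \<le> a * b"
  proof -
    have "sqrt (deg E u) * sqrt (deg E v) \<le> sqrt dmax * sqrt dmax"
      using deg_pos[of u] deg_pos[of v] by (intro mult_mono) (auto simp: dmax_def)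
    also have "\<dots> = dmax" using deg_pos[of u] by (simp add: dmax_def)
    finally show ?thesis using deg_pos[of u] deg_pos[of v] by (simp add: a_def b_def frac_le)
  qed
  moreover have "S \<ge> 0"
    unfolding S_def by (intro sum_nonneg walk_nonneg) (simp add: axis_def)
  ultimately have "1 / dmax * S \<le> a * b * S" by (rule mult_right_mono)
  then have "2 * (1 / dmax) * S \<le> 2 / dmin * (real r + 1 + \<mu> ^ (r + 1) / (1 - \<mu>)) - effective_resistance E u v"
    using key by linarith
  then show ?thesis
    using deg_pos[of u] unfolding S_def[symmetric] by (simp add: dmax_def field_simps)
qed

end

end

subsection \<open>Jacobians and the chain rule along curves\<close>

lemma vec_norm2_conv_L2_set: "vec_norm2 x = L2_set (vec_index x) {..<dim_vec x}"
  by (simp add: vec_norm2_def L2_set_def scalar_prod_def power2_eq_square lessThan_atLeast0)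

lemma vec_norm2_nonneg: "0 \<le> vec_norm2 x"
  by (simp add: vec_norm2_conv_L2_set)

lemma vec_norm2_zero: "vec_norm2 (0\<^sub>v n) = 0"
  by (simp add: vec_norm2_def scalar_prod_def)

lemma vec_norm2_eq_0: "vec_norm2 x = 0 \<Longrightarrow> x = 0\<^sub>v (dim_vec x)"
  by (auto simp: vec_norm2_conv_L2_set L2_set_eq_0_iff)

lemma vec_norm2_smult: "vec_norm2 (c \<cdot>\<^sub>v x) = \<bar>c\<bar> * vec_norm2 x"
  by (simp add: vec_norm2_conv_L2_set L2_set_def power_mult_distrib sum_distrib_left[symmetric] real_sqrt_mult)

lemma abs_vec_index_le_norm: "i < dim_vec x \<Longrightarrow> \<bar>vec_index x i\<bar> \<le> vec_norm2 x"
  using member_le_L2_set[of "{..<dim_vec x}" i "\<lambda>i. \<bar>vec_index x i\<bar>"]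
  by (simp add: vec_norm2_conv_L2_set L2_set_def)

lemma vec_norm2_le_sum_abs: "vec_norm2 x \<le> (\<Sum>i<dim_vec x. \<bar>vec_index x i\<bar>)"
  by (simp add: vec_norm2_conv_L2_set L2_set_le_sum_abs)

lemma scalar_prod_le_norms: "dim_vec x = dim_vec y \<Longrightarrow> \<bar>scalar_prod x y\<bar> \<le> vec_norm2 x * vec_norm2 y"
  unfolding vec_norm2_conv_L2_set scalar_prod_def lessThan_atLeast0[symmetric]
  by (rule order_trans[OF sum_abs]) (simp add: abs_mult L2_set_mult_ineq)

text \<open>Replacing the root of a sum of squares by a sum separates the own feature from the
  message, which is how \<open>I + A\<close> arises.\<close>

lemma vec_norm2_append: "vec_norm2 (x @\<^sub>v y) \<le> vec_norm2 x + vec_norm2 y"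
proof -
  have "scalar_prod (x @\<^sub>v y) (x @\<^sub>v y) = scalar_prod x x + scalar_prod y y"
    by (rule scalar_prod_append[of _ "dim_vec x" _ "dim_vec y"]) auto
  moreover have "0 \<le> scalar_prod x x" "0 \<le> scalar_prod y y"
    by (auto simp: scalar_prod_def intro: sum_nonneg)
  ultimately show ?thesis by (simp add: vec_norm2_def sqrt_add_le_add_sqrt)
qed

lemma vec_norm2_sum:
  assumes "finite S" "\<And>w. w \<in> S \<Longrightarrow> dim_vec (g w) = k"
  shows "vec_norm2 (Matrix.vec k (\<lambda>i. \<Sum>w\<in>S. c w * vec_index (g w) i))
    \<le> (\<Sum>w\<in>S. \<bar>c w\<bar> * vec_norm2 (g w))"
proof -
  have "L2_set (\<lambda>i. \<Sum>w\<in>S. c w * vec_index (g w) i) {..<k}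
    \<le> (\<Sum>w\<in>S. L2_set (\<lambda>i. c w * vec_index (g w) i) {..<k})"
    using \<open>finite S\<close>
  proof (induction S)
    case (insert a S)
    then show ?case by (simp add: order_trans[OF L2_set_triangle_ineq])
  qed (simp add: L2_set_def)
  also have "\<dots> = (\<Sum>w\<in>S. \<bar>c w\<bar> * vec_norm2 (g w))"
    using assms(2) by (intro sum.cong)
      (auto simp: vec_norm2_conv_L2_set L2_set_def power_mult_distrib sum_distrib_left[symmetric] real_sqrt_mult)
  also have "L2_set (\<lambda>i. \<Sum>w\<in>S. c w * vec_index (g w) i) {..<k}
    = vec_norm2 (Matrix.vec k (\<lambda>i. \<Sum>w\<in>S. c w * vec_index (g w) i))"
    unfolding vec_norm2_conv_L2_set by (intro L2_set_cong) auto
  finally show ?thesis .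
qed

text \<open>Cauchy-Schwarz on each row; boundedness makes the supremum in \<open>mat_norm2\<close>
  an upper bound.\<close>

lemma mat_norm2_bdd_above:
  "bdd_above {vec_norm2 (J *\<^sub>v x) | x. x \<in> carrier_vec (dim_col J) \<and> vec_norm2 x \<le> 1}"
proof -
  have "vec_norm2 (J *\<^sub>v x) \<le> (\<Sum>i<dim_row J. vec_norm2 (Matrix.row J i))"
    if x: "x \<in> carrier_vec (dim_col J)" "vec_norm2 x \<le> 1" for x
  proof -
    have "\<bar>scalar_prod (Matrix.row J i) x\<bar> \<le> vec_norm2 (Matrix.row J i)" if "i < dim_row J" for i
    proof -
      have "\<bar>scalar_prod (Matrix.row J i) x\<bar> \<le> vec_norm2 (Matrix.row J i) * vec_norm2 x"
        using x by (intro scalar_prod_le_norms) auto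
      also have "\<dots> \<le> vec_norm2 (Matrix.row J i)"
        using x(2) by (intro mult_left_le vec_norm2_nonneg)
      finally show ?thesis .
    qed
    then have "(\<Sum>i<dim_row J. \<bar>vec_index (J *\<^sub>v x) i\<bar>) \<le> (\<Sum>i<dim_row J. vec_norm2 (Matrix.row J i))"
      by (intro sum_mono) simp
    then show ?thesis using vec_norm2_le_sum_abs[of "J *\<^sub>v x"] by simp
  qed
  then show ?thesis by (intro bdd_aboveI) blast
qed

lemma mat_norm2_nonneg: "0 \<le> mat_norm2 J"
  unfolding mat_norm2_def
  by (rule cSup_upper2[OF _ vec_norm2_nonneg[of "J *\<^sub>v 0\<^sub>v (dim_col J)"] mat_norm2_bdd_above])
    (auto simp: vec_norm2_zero intro!: exI[of _ "0\<^sub>v (dim_col J)"])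

lemma vec_norm2_mult_mat_vec:
  assumes "J \<in> carrier_mat k n" "x \<in> carrier_vec n"
  shows "vec_norm2 (J *\<^sub>v x) \<le> mat_norm2 J * vec_norm2 x"
proof (cases "vec_norm2 x = 0")
  case True
  then have "x = 0\<^sub>v n" using vec_norm2_eq_0[of x] assms by auto
  then have "J *\<^sub>v x = 0\<^sub>v k" using assms by auto
  then show ?thesis using True by (simp add: vec_norm2_zero)
next
  case False
  then have pos: "vec_norm2 x > 0" using vec_norm2_nonneg[of x] by simp
  let ?y = "(1 / vec_norm2 x) \<cdot>\<^sub>v x"
  have "vec_norm2 (J *\<^sub>v ?y) \<le> mat_norm2 J"
    unfolding mat_norm2_def
    using assms pos by (intro cSup_upper mat_norm2_bdd_above)
      (auto simp: vec_norm2_smult intro!: exI[of _ ?y])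
  moreover have "J *\<^sub>v ?y = (1 / vec_norm2 x) \<cdot>\<^sub>v (J *\<^sub>v x)"
    using assms by (intro mult_mat_vec) auto
  ultimately show ?thesis using pos by (simp add: vec_norm2_smult field_simps)
qed

lemma mat_norm2_leI:
  assumes "J \<in> carrier_mat k n" "0 \<le> c" "\<And>x. x \<in> carrier_vec n \<Longrightarrow> vec_norm2 (J *\<^sub>v x) \<le> c * vec_norm2 x"
  shows "mat_norm2 J \<le> c"
  unfolding mat_norm2_def
proof (rule cSup_least)
  show "{vec_norm2 (J *\<^sub>v x) | x. x \<in> carrier_vec (dim_col J) \<and> vec_norm2 x \<le> 1} \<noteq> {}"
    using vec_norm2_zero[of "dim_col J"] by (auto intro!: exI[of _ "0\<^sub>v (dim_col J)"])
next
  fix y assume "y \<in> {vec_norm2 (J *\<^sub>v x) | x. x \<in> carrier_vec (dim_col J) \<and> vec_norm2 x \<le> 1}"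
  then obtain x where "y = vec_norm2 (J *\<^sub>v x)" "x \<in> carrier_vec n" "vec_norm2 x \<le> 1"
    using assms(1) by auto
  moreover have "c * vec_norm2 x \<le> c" using calculation(3) assms(2) by (rule mult_left_le)
  ultimately show "y \<le> c" using assms(3)[of x] by simp
qed

section \<open>Derivatives along curves\<close>

definition curve_deriv :: "nat \<Rightarrow> (real \<Rightarrow> real vec) \<Rightarrow> real vec \<Rightarrow> bool" where
  "curve_deriv n \<gamma> g \<longleftrightarrow> (\<forall>t. \<gamma> t \<in> carrier_vec n) \<and> g \<in> carrier_vec n \<and>
     (\<forall>i<n. ((\<lambda>t. vec_index (\<gamma> t) i) has_real_derivative vec_index g i) (at 0))"

text \<open>The condition inside \<open>vec_differentiable_at\<close> with its matrix exposed, so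
  that this matrix can be identified with \<open>vec_jacobian\<close>.\<close>

definition frechet_jacobian :: "(real vec \<Rightarrow> real vec) \<Rightarrow> real vec \<Rightarrow> real mat \<Rightarrow> bool" where
  "frechet_jacobian f x J \<longleftrightarrow> (\<forall>\<epsilon>>0. \<exists>\<delta>>0. \<forall>y \<in> carrier_vec (dim_vec x).
        vec_norm2 (y - x) < \<delta> \<longrightarrow>
        vec_norm2 (f y - f x - J *\<^sub>v (y - x)) \<le> \<epsilon> * vec_norm2 (y - x))"

text \<open>Chain rule: the Frechet remainder \<open>R t\<close> is at most a small multiple of
  \<open>N t\<close>, and \<open>N t / \<bar>t\<bar>\<close> has a finite limit, so
  \<open>R t / t\<close> tends to 0; what remains is linear in the curve.\<close>

lemma curve_deriv_frechet:
  assumes g: "curve_deriv n \<gamma> g" and f: "f \<in> carrier_vec n \<rightarrow> carrier_vec k"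
    and J: "J \<in> carrier_mat k n" "frechet_jacobian f (\<gamma> 0) J"
  shows "curve_deriv k (\<lambda>t. f (\<gamma> t)) (J *\<^sub>v g)"
proof -
  have car: "\<gamma> t \<in> carrier_vec n" "f (\<gamma> t) \<in> carrier_vec k" for t
    using g f by (auto simp: curve_deriv_def)
  have gc: "g \<in> carrier_vec n" using g by (simp add: curve_deriv_def)
  have der: "((\<lambda>t. vec_index (\<gamma> t) j) has_real_derivative vec_index g j) (at 0)" if "j < n" for j
    using g that by (simp add: curve_deriv_def)
  define R where "R t = f (\<gamma> t) - f (\<gamma> 0) - J *\<^sub>v (\<gamma> t - \<gamma> 0)" for t
  \<comment> \<open>The 1-norm of the displacement dominates the Euclidean norm, and its limits can
    be taken coordinatewise.\<close>
  define N where "N t = (\<Sum>j<n. \<bar>vec_index (\<gamma> t) j - vec_index (\<gamma> 0) j\<bar>)" for t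
  define C where "C = (\<Sum>j<n. \<bar>vec_index g j\<bar>)"
  have N: "vec_norm2 (\<gamma> t - \<gamma> 0) \<le> N t" for t
  proof -
    have "N t = (\<Sum>j<dim_vec (\<gamma> t - \<gamma> 0). \<bar>vec_index (\<gamma> t - \<gamma> 0) j\<bar>)"
      using car[of 0] car[of t] by (auto simp: N_def)
    then show ?thesis using vec_norm2_le_sum_abs[of "\<gamma> t - \<gamma> 0"] by simp
  qed
  have "(\<lambda>t. vec_index (\<gamma> t) j) \<midarrow>0\<rightarrow> vec_index (\<gamma> 0) j" if "j < n" for j
    using DERIV_isCont[OF der[OF that]] by (simp add: isCont_def)
  then have "N \<midarrow>0\<rightarrow> (\<Sum>j<n. \<bar>vec_index (\<gamma> 0) j - vec_index (\<gamma> 0) j\<bar>)"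
    unfolding N_def by (intro tendsto_intros) auto
  then have N0: "N \<midarrow>0\<rightarrow> 0" by simp
  have "(\<lambda>t. \<Sum>j<n. \<bar>(vec_index (\<gamma> t) j - vec_index (\<gamma> 0) j) / t\<bar>) \<midarrow>0\<rightarrow> C"
    unfolding C_def using der by (intro tendsto_intros) (simp add: DERIV_def)
  then have NC: "(\<lambda>t. N t / \<bar>t\<bar>) \<midarrow>0\<rightarrow> C"
    by (simp add: N_def abs_divide sum_divide_distrib)
  have "C \<ge> 0" by (simp add: C_def sum_nonneg)
  have Rder: "((\<lambda>t. vec_index (R t) i) has_real_derivative 0) (at 0)" if i: "i < k" for i
  proof -
    have dimR: "dim_vec (R t) = k" for t using J by (simp add: R_def)
    have "R 0 = 0\<^sub>v k"
      using J car[of 0] by (auto simp: R_def scalar_prod_def)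
    then have R0: "vec_index (R 0) i = 0" using i by simp
    have "(\<lambda>t. vec_index (R t) i / t) \<midarrow>0\<rightarrow> 0"
    proof (rule tendstoI)
      fix \<epsilon> :: real assume "\<epsilon> > 0"
      \<comment> \<open>The denominator is positive even for \<open>C = 0\<close> and exceeds
        \<open>C + 1\<close>, the eventual bound on \<open>N t / \<bar>t\<bar>\<close>.\<close>
      define \<epsilon>' where "\<epsilon>' = \<epsilon> / (C + 2)"
      have "\<epsilon>' > 0" using \<open>\<epsilon> > 0\<close> \<open>C \<ge> 0\<close> by (simp add: \<epsilon>'_def)
      then obtain \<delta> where "\<delta> > 0" and \<delta>: "\<And>y. y \<in> carrier_vec (dim_vec (\<gamma> 0)) \<Longrightarrow> vec_norm2 (y - \<gamma> 0) < \<delta> \<Longrightarrow>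
        vec_norm2 (f y - f (\<gamma> 0) - J *\<^sub>v (y - \<gamma> 0)) \<le> \<epsilon>' * vec_norm2 (y - \<gamma> 0)"
        using J(2) unfolding frechet_jacobian_def by blast
      have "\<forall>\<^sub>F t in at 0. N t < \<delta>" using order_tendstoD(2)[OF N0 \<open>\<delta> > 0\<close>] .
      moreover have "\<forall>\<^sub>F t in at 0. N t / \<bar>t\<bar> < C + 1" using order_tendstoD(2)[OF NC] by simp
      moreover have "\<forall>\<^sub>F t in at 0. t \<noteq> (0::real)" by (simp add: eventually_at_filter)
      ultimately show "\<forall>\<^sub>F t in at 0. dist (vec_index (R t) i / t) 0 < \<epsilon>"
      proof eventually_elim
        case (elim t)
        have "\<bar>vec_index (R t) i\<bar> \<le> vec_norm2 (R t)"
          using abs_vec_index_le_norm i dimR by simp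
        also have "\<dots> \<le> \<epsilon>' * vec_norm2 (\<gamma> t - \<gamma> 0)"
          unfolding R_def using car(1)[of t] car(1)[of 0] N[of t] elim(1) by (intro \<delta>) auto
        also have "\<dots> \<le> \<epsilon>' * N t" using N \<open>\<epsilon>' > 0\<close> by simp
        finally have "\<bar>vec_index (R t) i\<bar> / \<bar>t\<bar> \<le> \<epsilon>' * N t / \<bar>t\<bar>" by (simp add: divide_right_mono)
        also have "\<dots> = \<epsilon>' * (N t / \<bar>t\<bar>)" by simp
        also have "\<dots> < \<epsilon>' * (C + 2)" using elim(2) \<open>\<epsilon>' > 0\<close> by (intro mult_strict_left_mono) auto
        also have "\<dots> = \<epsilon>" using \<open>C \<ge> 0\<close> by (simp add: \<epsilon>'_def)
        finally show ?case by (simp add: abs_divide)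
      qed
    qed
    then show ?thesis by (simp add: DERIV_def R0)
  qed
  have "((\<lambda>t. vec_index (f (\<gamma> t)) i) has_real_derivative vec_index (J *\<^sub>v g) i) (at 0)" if i: "i < k" for i
  proof -
    define c where "c = vec_index (f (\<gamma> 0)) i"
    have eq: "vec_index (f (\<gamma> t)) i = vec_index (R t) i + c
        + (\<Sum>j<n. J $$ (i, j) * (vec_index (\<gamma> t) j - vec_index (\<gamma> 0) j))" for t
    proof -
      have "vec_index (J *\<^sub>v (\<gamma> t - \<gamma> 0)) i = (\<Sum>j<n. J $$ (i, j) * (vec_index (\<gamma> t) j - vec_index (\<gamma> 0) j))"
        using J i car(1)[of t] car(1)[of 0] by (auto simp: scalar_prod_def lessThan_atLeast0 intro!: sum.cong)
      then show ?thesis using J i car(2)[of t] car(2)[of 0] by (simp add: R_def c_def)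
    qed
    have "((\<lambda>t. vec_index (R t) i + c
        + (\<Sum>j<n. J $$ (i, j) * (vec_index (\<gamma> t) j - vec_index (\<gamma> 0) j))) has_real_derivative
        0 + 0 + (\<Sum>j<n. J $$ (i, j) * (vec_index g j - 0))) (at 0)"
      by (intro DERIV_add DERIV_sum DERIV_const DERIV_cmult DERIV_diff Rder i der) auto
    moreover have "vec_index (J *\<^sub>v g) i = (\<Sum>j<n. J $$ (i, j) * vec_index g j)"
      using J i gc by (auto simp: scalar_prod_def lessThan_atLeast0 intro!: sum.cong)
    ultimately show ?thesis unfolding eq by simp
  qed
  then show ?thesis using car J gc by (auto simp: curve_deriv_def)
qed

lemma curve_deriv_line:
  assumes "x \<in> carrier_vec n" "\<xi> \<in> carrier_vec n"
  shows "curve_deriv n (\<lambda>t. x + t \<cdot>\<^sub>v \<xi>) \<xi>"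
  unfolding curve_deriv_def
proof (intro conjI allI impI)
  fix i assume "i < n"
  then have "vec_index (x + t \<cdot>\<^sub>v \<xi>) i = vec_index x i + t * vec_index \<xi> i" for t
    using assms by simp
  then show "((\<lambda>t. vec_index (x + t \<cdot>\<^sub>v \<xi>) i) has_real_derivative vec_index \<xi> i) (at 0)"
    by (auto intro!: derivative_eq_intros)
qed (use assms in auto)

lemma curve_deriv_const: "c \<in> carrier_vec n \<Longrightarrow> curve_deriv n (\<lambda>t. c) (0\<^sub>v n)"
  by (auto simp: curve_deriv_def)

lemma curve_deriv_append:
  assumes "curve_deriv n \<gamma> g" "curve_deriv k \<eta> h"
  shows "curve_deriv (n + k) (\<lambda>t. \<gamma> t @\<^sub>v \<eta> t) (g @\<^sub>v h)"
proof -
  have dims: "\<And>t. dim_vec (\<gamma> t) = n" "dim_vec g = n" "\<And>t. dim_vec (\<eta> t) = k" "dim_vec h = k"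
    using assms by (auto simp: curve_deriv_def)
  show ?thesis
    using assms by (auto simp: curve_deriv_def dims)
qed

lemma curve_deriv_sum:
  assumes "\<And>w. w \<in> S \<Longrightarrow> curve_deriv k (\<gamma> w) (g w)"
  shows "curve_deriv k (\<lambda>t. Matrix.vec k (\<lambda>i. \<Sum>w\<in>S. c w * vec_index (\<gamma> w t) i))
    (Matrix.vec k (\<lambda>i. \<Sum>w\<in>S. c w * vec_index (g w) i))"
  using assms by (auto simp: curve_deriv_def intro!: DERIV_sum DERIV_cmult)

text \<open>The direction \<open>unit_vec n j\<close> picks out column \<open>j\<close> of
  \<open>J\<close>, whose entries are then the partial derivatives.\<close>

lemma vec_jacobian_eqI:
  assumes "J \<in> carrier_mat k n" "x \<in> carrier_vec n" "f x \<in> carrier_vec k"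
    and "\<And>\<xi>. \<xi> \<in> carrier_vec n \<Longrightarrow> curve_deriv k (\<lambda>t. f (x + t \<cdot>\<^sub>v \<xi>)) (J *\<^sub>v \<xi>)"
  shows "vec_jacobian f x = J"
proof (rule eq_matI)
  fix i j assume ij: "i < dim_row J" "j < dim_col J"
  have "((\<lambda>t. vec_index (f (x + t \<cdot>\<^sub>v unit_vec n j)) i) has_real_derivative
      vec_index (J *\<^sub>v unit_vec n j) i) (at 0)"
    using assms(4)[of "unit_vec n j"] ij assms(1) by (simp add: curve_deriv_def)
  moreover have "vec_index (J *\<^sub>v unit_vec n j) i = J $$ (i, j)"
    using ij assms(1) by (simp add: scalar_prod_right_unit)
  ultimately show "vec_jacobian f x $$ (i, j) = J $$ (i, j)"
    using ij assms(1-3) by (simp add: vec_jacobian_def DERIV_imp_deriv)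
qed (use assms in \<open>auto simp: vec_jacobian_def\<close>)

text \<open>The chain rule along lines shows that the Frechet derivative is the matrix of partial
  derivatives, so the assumed norm bounds apply to it.\<close>

lemma curve_deriv_vec_jacobian:
  assumes "curve_deriv n \<gamma> g" "f \<in> carrier_vec n \<rightarrow> carrier_vec k"
    and "vec_differentiable_at f (\<gamma> 0)"
  shows "curve_deriv k (\<lambda>t. f (\<gamma> t)) (vec_jacobian f (\<gamma> 0) *\<^sub>v g)"
proof -
  have x: "\<gamma> 0 \<in> carrier_vec n" "f (\<gamma> 0) \<in> carrier_vec k"
    using assms(1,2) by (auto simp: curve_deriv_def)
  then obtain J where J: "J \<in> carrier_mat k n" "frechet_jacobian f (\<gamma> 0) J"
    using assms(3) by (auto simp: vec_differentiable_at_def frechet_jacobian_def)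
  have "vec_jacobian f (\<gamma> 0) = J"
  proof (rule vec_jacobian_eqI[where f = f, OF J(1) x])
    fix \<xi> :: "real vec" assume \<xi>: "\<xi> \<in> carrier_vec n"
    have "\<gamma> 0 + 0 \<cdot>\<^sub>v \<xi> = \<gamma> 0" using x(1) \<xi> by auto
    then show "curve_deriv k (\<lambda>t. f (\<gamma> 0 + t \<cdot>\<^sub>v \<xi>)) (J *\<^sub>v \<xi>)"
      using curve_deriv_frechet[OF curve_deriv_line[OF x(1) \<xi>] assms(2) J(1)] J(2) by simp
  qed
  then show ?thesis using curve_deriv_frechet[OF assms(1,2) J] by simp
qed

subsection \<open>Jacobians of graph neural networks\<close>

lemma gnn_feature_carrier:
  assumes "gnn_functions d e \<phi> \<psi>" "\<And>w. x w \<in> carrier_vec (d 0)"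
  shows "gnn_feature E e \<phi> \<psi> x l w \<in> carrier_vec (d l)"
proof (induction l arbitrary: w)
  case (Suc l)
  have "\<phi> l \<in> carrier_vec (d l + e l) \<rightarrow> carrier_vec (d (Suc l))"
    using assms(1) by (simp add: gnn_functions_def)
  then show ?case using Suc by (auto elim!: Pi_mem)
qed (use assms in simp)

text \<open>Induction over layers, carrying a matrix \<open>K w\<close> for the derivative of each
  feature with a bound on every \<open>K w *\<^sub>v \<xi>\<close>. The scalars \<open>q\<close> are
  any sequence with the recursion of \<open>(I + A)^l\<close> applied to the indicator of
  \<open>v\<close>.\<close>

lemma gnn_curve_deriv:
  fixes q :: "nat \<Rightarrow> 'v::finite \<Rightarrow> real"
  assumes gnn: "gnn_functions d e \<phi> \<psi>"
    and x: "\<And>w. x w \<in> carrier_vec (d 0)"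
    and \<alpha>: "\<And>l z. z \<in> carrier_vec (d l + e l) \<Longrightarrow> mat_norm2 (vec_jacobian (\<phi> l) z) \<le> \<alpha>"
    and \<beta>: "\<And>l y. y \<in> carrier_vec (d l) \<Longrightarrow> max (mat_norm2 (vec_jacobian (\<psi> l) y)) 1 \<le> \<beta>"
    and A: "\<And>i j. 0 \<le> norm_adjacency E $ i $ j"
    and q0: "\<And>w. q 0 w = (if w = v then 1 else 0)"
    and qSuc: "\<And>l w. q (Suc l) w = q l w + (\<Sum>w'\<in>neighbors E w. norm_adjacency E $ w $ w' * q l w')"
  shows "\<exists>K. \<forall>w. K w \<in> carrier_mat (d l) (d 0) \<and> (\<forall>\<xi>\<in>carrier_vec (d 0).
    curve_deriv (d l) (\<lambda>t. gnn_feature E e \<phi> \<psi> (x(v := x v + t \<cdot>\<^sub>v \<xi>)) l w) (K w *\<^sub>v \<xi>) \<and>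
    vec_norm2 (K w *\<^sub>v \<xi>) \<le> (\<alpha> * \<beta>) ^ l * q l w * vec_norm2 \<xi>)"
proof (induction l)
  case 0
  \<comment> \<open>Only the input at \<open>v\<close> is perturbed: identity there, zero
    elsewhere.\<close>
  define K where "K w = (if w = v then 1\<^sub>m (d 0) else 0\<^sub>m (d 0) (d 0) :: real mat)" for w
  have K: "K w *\<^sub>v \<xi> = (if w = v then \<xi> else 0\<^sub>v (d 0))" if "\<xi> \<in> carrier_vec (d 0)" for w \<xi>
    using that by (auto simp: K_def)
  have "curve_deriv (d 0) (\<lambda>t. (x(v := x v + t \<cdot>\<^sub>v \<xi>)) w) (K w *\<^sub>v \<xi>)"
    if "\<xi> \<in> carrier_vec (d 0)" for w \<xi>
    using x that by (simp add: K curve_deriv_line curve_deriv_const)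
  then show ?case
    by (intro exI[of _ K]) (simp add: K q0 vec_norm2_zero, simp add: K_def)
next
  case (Suc l)
  have "0 \<le> \<alpha>" using \<alpha>[of "0\<^sub>v (d 0 + e 0)" 0] mat_norm2_nonneg by (meson order_trans zero_carrier_vec)
  have "1 \<le> \<beta>" using \<beta>[of "0\<^sub>v (d 0)" 0] by simp
  have f: "\<phi> l \<in> carrier_vec (d l + e l) \<rightarrow> carrier_vec (d (Suc l))"
      "\<psi> l \<in> carrier_vec (d l) \<rightarrow> carrier_vec (e l)"
      "\<And>z. z \<in> carrier_vec (d l + e l) \<Longrightarrow> vec_differentiable_at (\<phi> l) z"
      "\<And>z. z \<in> carrier_vec (d l) \<Longrightarrow> vec_differentiable_at (\<psi> l) z"
    using gnn by (simp_all add: gnn_functions_def)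
  obtain K where K: "\<And>w. K w \<in> carrier_mat (d l) (d 0)"
    and Kd: "\<And>w \<xi>. \<xi> \<in> carrier_vec (d 0) \<Longrightarrow>
      curve_deriv (d l) (\<lambda>t. gnn_feature E e \<phi> \<psi> (x(v := x v + t \<cdot>\<^sub>v \<xi>)) l w) (K w *\<^sub>v \<xi>)"
    and Kn: "\<And>w \<xi>. \<xi> \<in> carrier_vec (d 0) \<Longrightarrow> vec_norm2 (K w *\<^sub>v \<xi>) \<le> (\<alpha> * \<beta>) ^ l * q l w * vec_norm2 \<xi>"
    using Suc by blast
  let ?a = "\<lambda>w w'. norm_adjacency E $ w $ w'"
  define h where "h w = gnn_feature E e \<phi> \<psi> x l w" for w
  have h: "h w \<in> carrier_vec (d l)" for w
    unfolding h_def using gnn_feature_carrier[OF gnn x] .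
  define z where "z w = h w @\<^sub>v Matrix.vec (e l) (\<lambda>i. \<Sum>w'\<in>neighbors E w. ?a w w' * vec_index (\<psi> l (h w')) i)" for w
  have z: "z w \<in> carrier_vec (d l + e l)" for w
    using h by (auto simp: z_def)
  define B where "B w = vec_jacobian (\<psi> l) (h w)" for w
  define J where "J w = vec_jacobian (\<phi> l) (z w)" for w
  have B: "B w \<in> carrier_mat (e l) (d l)" for w
    using Pi_mem[OF f(2) h[of w]] h[of w] by (simp add: B_def vec_jacobian_def)
  have J: "J w \<in> carrier_mat (d (Suc l)) (d l + e l)" for w
    using Pi_mem[OF f(1) z[of w]] z[of w] by (simp add: J_def vec_jacobian_def)
  \<comment> \<open>\<open>M w\<close> is the Jacobian of the aggregated message at
    \<open>w\<close>.\<close>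
  define M where "M w = Matrix.mat (e l) (d 0)
    (\<lambda>(i, j). \<Sum>w'\<in>neighbors E w. ?a w w' * (B w' * K w') $$ (i, j))" for w
  have M: "M w \<in> carrier_mat (e l) (d 0)" for w by (simp add: M_def)
  have M_xi: "M w *\<^sub>v \<xi> = Matrix.vec (e l) (\<lambda>i. \<Sum>w'\<in>neighbors E w. ?a w w' * vec_index (B w' *\<^sub>v (K w' *\<^sub>v \<xi>)) i)"
    if \<xi>: "\<xi> \<in> carrier_vec (d 0)" for w \<xi>
  proof (rule eq_vecI)
    fix i assume "i < dim_vec (Matrix.vec (e l) (\<lambda>i. \<Sum>w'\<in>neighbors E w. ?a w w' * vec_index (B w' *\<^sub>v (K w' *\<^sub>v \<xi>)) i))"
    then have i: "i < e l" by simp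
    have "vec_index (B w' *\<^sub>v (K w' *\<^sub>v \<xi>)) i = (\<Sum>j<d 0. (B w' * K w') $$ (i, j) * vec_index \<xi> j)" for w'
    proof -
      have "B w' *\<^sub>v (K w' *\<^sub>v \<xi>) = (B w' * K w') *\<^sub>v \<xi>"
        using assoc_mult_mat_vec[OF B K \<xi>] by simp
      moreover have "B w' * K w' \<in> carrier_mat (e l) (d 0)" using mult_carrier_mat[OF B K] .
      ultimately show ?thesis using i \<xi>
        by (simp del: index_mult_mat add: scalar_prod_def lessThan_atLeast0 Matrix.row_def)
    qed
    moreover have "vec_index (M w *\<^sub>v \<xi>) i = (\<Sum>j<d 0. (\<Sum>w'\<in>neighbors E w. ?a w w' * (B w' * K w') $$ (i, j)) * vec_index \<xi> j)"
      using i \<xi> by (simp del: index_mult_mat add: M_def scalar_prod_def lessThan_atLeast0 Matrix.row_def)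
    ultimately show "vec_index (M w *\<^sub>v \<xi>) i = vec_index (Matrix.vec (e l) (\<lambda>i. \<Sum>w'\<in>neighbors E w. ?a w w' * vec_index (B w' *\<^sub>v (K w' *\<^sub>v \<xi>)) i)) i"
      using i by (simp add: sum_distrib_left sum_distrib_right mult.assoc sum.swap[of _ "{..<d 0}"])
  qed (simp add: M_def)
  \<comment> \<open>Chain rule for \<open>\<phi> l\<close>: its joint Jacobian times the stacked
    Jacobians of its two arguments.\<close>
  define K' where "K' w = J w * (K w @\<^sub>r M w)" for w
  have K': "K' w \<in> carrier_mat (d (Suc l)) (d 0)" for w
    unfolding K'_def using mult_carrier_mat[OF J carrier_append_rows[OF K M]] .
  have K'_xi: "K' w *\<^sub>v \<xi> = J w *\<^sub>v ((K w *\<^sub>v \<xi>) @\<^sub>v (M w *\<^sub>v \<xi>))" if \<xi>: "\<xi> \<in> carrier_vec (d 0)" for w \<xi>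
    unfolding K'_def assoc_mult_mat_vec[OF J carrier_append_rows[OF K M] \<xi>] mat_mult_append[OF K M \<xi>] ..
  show ?case
  proof (intro exI[of _ K'] allI conjI ballI K')
    fix w and \<xi> :: "real vec" assume \<xi>: "\<xi> \<in> carrier_vec (d 0)"
    define \<gamma> where "\<gamma> w t = gnn_feature E e \<phi> \<psi> (x(v := x v + t \<cdot>\<^sub>v \<xi>)) l w" for w t
    have "x v + 0 \<cdot>\<^sub>v \<xi> = x v" using x[of v] \<xi> by auto
    then have \<gamma>_0: "\<gamma> w 0 = h w" for w by (simp add: \<gamma>_def h_def)
    have \<gamma>: "curve_deriv (d l) (\<gamma> w) (K w *\<^sub>v \<xi>)" for w unfolding \<gamma>_def using Kd[OF \<xi>] .
    have "curve_deriv (e l) (\<lambda>t. \<psi> l (\<gamma> w t)) (B w *\<^sub>v (K w *\<^sub>v \<xi>))" for w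
      using curve_deriv_vec_jacobian[OF \<gamma> f(2)] f(4) h by (simp add: \<gamma>_0 B_def)
    then have "curve_deriv (d l + e l) (\<lambda>t. \<gamma> w t @\<^sub>v Matrix.vec (e l) (\<lambda>i. \<Sum>w'\<in>neighbors E w. ?a w w' * vec_index (\<psi> l (\<gamma> w' t)) i))
      ((K w *\<^sub>v \<xi>) @\<^sub>v (M w *\<^sub>v \<xi>))"
      unfolding M_xi[OF \<xi>] by (intro curve_deriv_append \<gamma> curve_deriv_sum)
    from curve_deriv_vec_jacobian[OF this f(1)] f(3) z[of w]
    show "curve_deriv (d (Suc l)) (\<lambda>t. gnn_feature E e \<phi> \<psi> (x(v := x v + t \<cdot>\<^sub>v \<xi>)) (Suc l) w) (K' w *\<^sub>v \<xi>)"
      by (simp add: \<gamma>_0 \<gamma>_def[symmetric] z_def[symmetric] J_def[symmetric] K'_xi[OF \<xi>])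
    let ?c = "(\<alpha> * \<beta>) ^ l * vec_norm2 \<xi>"
    have Mn: "vec_norm2 (M w *\<^sub>v \<xi>) \<le> \<beta> * ((\<Sum>w'\<in>neighbors E w. ?a w w' * q l w') * ?c)"
    proof -
      have "vec_norm2 (M w *\<^sub>v \<xi>) \<le> (\<Sum>w'\<in>neighbors E w. \<bar>?a w w'\<bar> * vec_norm2 (B w' *\<^sub>v (K w' *\<^sub>v \<xi>)))"
        unfolding M_xi[OF \<xi>] using B by (intro vec_norm2_sum) auto
      also have "\<dots> \<le> (\<Sum>w'\<in>neighbors E w. ?a w w' * (\<beta> * (q l w' * ?c)))"
      proof (rule sum_mono)
        fix w'
        have "vec_norm2 (B w' *\<^sub>v (K w' *\<^sub>v \<xi>)) \<le> mat_norm2 (B w') * vec_norm2 (K w' *\<^sub>v \<xi>)"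
          by (rule vec_norm2_mult_mat_vec[OF B mult_mat_vec_carrier[OF K \<xi>]])
        also have "\<dots> \<le> \<beta> * (q l w' * ?c)"
          using \<beta>[OF h[of w']] Kn[OF \<xi>, of w'] \<open>1 \<le> \<beta>\<close> vec_norm2_nonneg
          by (intro mult_mono) (auto simp: B_def mult_ac)
        finally show "\<bar>?a w w'\<bar> * vec_norm2 (B w' *\<^sub>v (K w' *\<^sub>v \<xi>)) \<le> ?a w w' * (\<beta> * (q l w' * ?c))"
          using A by (simp add: mult_left_mono)
      qed
      also have "\<dots> = \<beta> * ((\<Sum>w'\<in>neighbors E w. ?a w w' * q l w') * ?c)"
        by (simp add: sum_distrib_left sum_distrib_right mult_ac)
      finally show ?thesis .
    qed
    \<comment> \<open>Here \<open>1 \<le> \<beta>\<close> lets the own-feature term carry the same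
      factor \<open>\<beta>\<close> as the message term. The needed sign comes from the induction
      bound, which dominates a norm.\<close>
    have "0 \<le> q l w * ?c" using Kn[OF \<xi>, of w] vec_norm2_nonneg[of "K w *\<^sub>v \<xi>"] by (simp add: mult_ac)
    then have "q l w * ?c \<le> \<beta> * (q l w * ?c)"
      using mult_right_mono[OF \<open>1 \<le> \<beta>\<close>] by fastforce
    then have Kn': "vec_norm2 (K w *\<^sub>v \<xi>) \<le> \<beta> * (q l w * ?c)"
      using Kn[OF \<xi>, of w] by (simp add: mult_ac)
    have "vec_norm2 (K' w *\<^sub>v \<xi>) \<le> mat_norm2 (J w) * vec_norm2 ((K w *\<^sub>v \<xi>) @\<^sub>v (M w *\<^sub>v \<xi>))"
      unfolding K'_xi[OF \<xi>]
      by (rule vec_norm2_mult_mat_vec[OF J append_carrier_vec[OF mult_mat_vec_carrier[OF K \<xi>] mult_mat_vec_carrier[OF M \<xi>]]])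
    also have "\<dots> \<le> \<alpha> * (\<beta> * (q l w * ?c) + \<beta> * ((\<Sum>w'\<in>neighbors E w. ?a w w' * q l w') * ?c))"
      using \<alpha>[OF z[of w]] \<open>0 \<le> \<alpha>\<close> vec_norm2_nonneg
      by (intro mult_mono order_trans[OF vec_norm2_append add_mono[OF Kn' Mn]]) (auto simp: J_def)
    also have "\<dots> = (\<alpha> * \<beta>) ^ Suc l * q (Suc l) w * vec_norm2 \<xi>"
      by (simp add: qSuc algebra_simps)
    finally show "vec_norm2 (K' w *\<^sub>v \<xi>) \<le> (\<alpha> * \<beta>) ^ Suc l * q (Suc l) w * vec_norm2 \<xi>" .
  qed
qed

text \<open>The matrix from \<open>gnn_curve_deriv\<close> is the Jacobian, and its vectorwise bound
  is an operator norm bound.\<close>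

lemma mat_norm2_gnn_jacobian_le:
  fixes q :: "nat \<Rightarrow> 'v::finite \<Rightarrow> real"
  assumes gnn: "gnn_functions d e \<phi> \<psi>"
    and x: "\<And>w. x w \<in> carrier_vec (d 0)"
    and \<alpha>: "\<And>l z. z \<in> carrier_vec (d l + e l) \<Longrightarrow> mat_norm2 (vec_jacobian (\<phi> l) z) \<le> \<alpha>"
    and \<beta>: "\<And>l y. y \<in> carrier_vec (d l) \<Longrightarrow> max (mat_norm2 (vec_jacobian (\<psi> l) y)) 1 \<le> \<beta>"
    and A: "\<And>i j. 0 \<le> norm_adjacency E $ i $ j"
    and q0: "\<And>w. q 0 w = (if w = v then 1 else 0)"
    and qSuc: "\<And>l w. q (Suc l) w = q l w + (\<Sum>w'\<in>neighbors E w. norm_adjacency E $ w $ w' * q l w')"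
  shows "mat_norm2 (vec_jacobian (\<lambda>y. gnn_feature E e \<phi> \<psi> (x(v := y)) l u) (x v)) \<le> (\<alpha> * \<beta>) ^ l * q l u"
proof -
  obtain K where K: "K \<in> carrier_mat (d l) (d 0)"
    and Kd: "\<And>\<xi>. \<xi> \<in> carrier_vec (d 0) \<Longrightarrow>
      curve_deriv (d l) (\<lambda>t. gnn_feature E e \<phi> \<psi> (x(v := x v + t \<cdot>\<^sub>v \<xi>)) l u) (K *\<^sub>v \<xi>)"
    and Kn: "\<And>\<xi>. \<xi> \<in> carrier_vec (d 0) \<Longrightarrow> vec_norm2 (K *\<^sub>v \<xi>) \<le> (\<alpha> * \<beta>) ^ l * q l u * vec_norm2 \<xi>"
    using gnn_curve_deriv[OF assms] by meson
  have "0 \<le> \<alpha>" using \<alpha>[of "0\<^sub>v (d 0 + e 0)" 0] mat_norm2_nonneg by (meson order_trans zero_carrier_vec)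
  moreover have "1 \<le> \<beta>" using \<beta>[of "0\<^sub>v (d 0)" 0] by simp
  moreover have "0 \<le> q l w" for w
    by (induction l arbitrary: w) (auto simp: q0 qSuc A intro!: add_nonneg_nonneg sum_nonneg)
  ultimately have "0 \<le> (\<alpha> * \<beta>) ^ l * q l u" by simp
  moreover have "vec_jacobian (\<lambda>y. gnn_feature E e \<phi> \<psi> (x(v := y)) l u) (x v) = K"
    using K x Kd gnn_feature_carrier[OF gnn x] by (intro vec_jacobian_eqI) auto
  ultimately show ?thesis using mat_norm2_leI[OF K _ Kn] by simp
qed

section \<open>The Jacobian bound in terms of effective resistance\<close>

theorem theorem3p3:
  fixes E :: "'v::finite \<Rightarrow> 'v \<Rightarrow> bool"
    and d e :: "nat \<Rightarrow> nat"
    and \<phi> \<psi> :: "nat \<Rightarrow> real vec \<Rightarrow> real vec"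
    and x :: "'v \<Rightarrow> real vec"
    and u v :: 'v
    and r :: nat
    and \<alpha> \<beta> \<mu> d_min d_max :: real
    and m :: "nat \<Rightarrow> real"
  assumes "simple_graph E" and "connected_graph E" and "\<not> bipartite_graph E"
    and "gnn_functions d e \<phi> \<psi>"
    and "\<And>w. x w \<in> carrier_vec (d 0)"
    and "\<And>l z. z \<in> carrier_vec (d l + e l) \<Longrightarrow> mat_norm2 (vec_jacobian (\<phi> l) z) \<le> \<alpha>"
    and "\<And>l y. y \<in> carrier_vec (d l) \<Longrightarrow> max (mat_norm2 (vec_jacobian (\<psi> l) y)) 1 \<le> \<beta>"
    and "d_min = min (real (vertex_degree E u)) (real (vertex_degree E v))"
    and "d_max = max (real (vertex_degree E u)) (real (vertex_degree E v))"
    and "eigenvalues_desc (norm_adjacency E) m"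
    and "max \<bar>m 2\<bar> \<bar>m CARD('v)\<bar> \<le> \<mu>" and "\<mu> < 1"
  shows "mat_norm2 (vec_jacobian (\<lambda>y. gnn_feature E e \<phi> \<psi> (x(v := y)) r u) (x v))
    \<le> (2 * \<alpha> * \<beta>) ^ r * (d_max / 2) *
      (2 / d_min * (real r + 1 + \<mu> ^ (r + 1) / (1 - \<mu>)) - effective_resistance E u v)"
proof -
  interpret nonbipartite_graph E
    using assms(1-3) by unfold_locales
  have "0 \<le> \<alpha>"
    using assms(6)[of "0\<^sub>v (d 0 + e 0)" 0] mat_norm2_nonneg by (meson order_trans zero_carrier_vec)
  moreover have "1 \<le> \<beta>"
    using assms(7)[of "0\<^sub>v (d 0)" 0] by simp
  ultimately have nonneg: "0 \<le> \<alpha> * \<beta>" by simp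
  have ax: "0 \<le> axis v (1::real) $ i" for i
    by (simp add: axis_def)
  \<comment> \<open>Here \<open>q l w\<close> is the entry at \<open>w\<close> of
    \<open>lazy_walk l\<close> applied to the indicator of \<open>v\<close>.\<close>
  have "mat_norm2 (vec_jacobian (\<lambda>y. gnn_feature E e \<phi> \<psi> (x(v := y)) r u) (x v))
    \<le> (\<alpha> * \<beta>) ^ r * lazy_walk r (axis v 1) $ u"
    by (rule mat_norm2_gnn_jacobian_le[OF assms(4-7) A_nonneg])
      (auto simp: axis_def norm_adjacency_mult)
  also have "\<dots> \<le> (\<alpha> * \<beta>) ^ r * (2 ^ r * (\<Sum>l\<le>r. walk l (axis v 1) $ u))"
    using nonneg by (intro mult_left_mono lazy_walk_le ax) auto
  also have "\<dots> = (2 * \<alpha> * \<beta>) ^ r * (\<Sum>l\<le>r. walk l (axis v 1) $ u)"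
    by (simp add: power_mult_distrib)
  also have "\<dots> \<le> (2 * \<alpha> * \<beta>) ^ r *
      (d_max / 2 * (2 / d_min * (real r + 1 + \<mu> ^ (r + 1) / (1 - \<mu>)) - effective_resistance E u v))"
    using walk_sum_le_resistance[OF assms(10-12), where r = r and u = u and v = v] nonneg
    by (intro mult_left_mono) (simp_all add: assms(8,9) deg_def mult.assoc)
  finally show ?thesis by (simp add: mult.assoc)
qed

end
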